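(* Fix $\gamma\in(0,1/2)$, $\alpha>0$, $\beta\in[0,1/2)$, $\varepsilon_0\in(0,1)$, $q\ge2$ and $A>\sqrt2\,M_q^{1/q}$. Then there is a generic constant $C>0$ (its value may differ at each occurrence), depending only on $\alpha,\beta,\varepsilon_0,q,A$ and $\gamma$, such that for all sufficiently large $n$ $$R_n^{\varepsilon,a}(\tilde{\mathcal{F}}(\alpha,\beta,\varepsilon_0,q,A;n))\ \ge\ C\,n^{-2\beta}\log^{-\alpha}(n)$$ and $$\sup_{f\in\tilde{\mathcal{F}}(\alpha,\beta,\varepsilon_0,q,A;n)}E[\hat\varepsilon_n(\gamma)-\varepsilon]^2\ \le\ C\big(n^{-2\beta}\log^{-\alpha}(n)+n^{2\gamma-1}\big).$$ In particular, if $\gamma<1/2-\beta$, then $\hat\varepsilon_n(\gamma)$ attains the optimal rate of convergence, i.e. its maximal risk over $\tilde{\mathcal{F}}(\alpha,\beta,\varepsilon_0,q,A;n)$ is of the same order $n^{-2\beta}\log^{-\alpha}(n)$ as the minimax risk $R_n^{\varepsilon,a}$.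
   Context: Model with known null parameters, normalized to $u_0=0$, $\sigma_0=1$. $\phi$ denotes the density of $N(0,1)$ and $M_q=E|Z|^q$ for $Z\sim N(0,1)$. One observes $X_1,\dots,X_n$ i.i.d. with density $$f(x)=(1-\varepsilon)\phi(x)+\varepsilon\int\frac1\sigma\phi\Big(\frac{x-u}{\sigma}\Big)\,dH(u,\sigma),$$ where $\varepsilon\in(0,1)$ (it may depend on $n$) and $H$ is a mixing distribution on $(u,\sigma)$. Let $H(\sigma)$ be the marginal distribution of $\sigma$ and $H(u|\sigma)$ the conditional distribution of $u$ given $\sigma$. The density $f$ is eligible if $H(\sigma)$ is supported on $[1,\infty)$ and $H(u|\sigma)$ has a density $h(u|\sigma)$ for every $\sigma\ge1$; $\mathcal{F}$ is the set of eligible $f$ (for these $\varepsilon$ is identifiable). Write $\hat h(t|\sigma)=\int e^{itu}h(u|\sigma)\,du$, with $\hat h'$ the derivative in $t$. Parameter space. $\tilde{\mathcal{F}}(\alpha,\beta,\varepsilon_0,q,A;n)$ is the set of $f\in\mathcal{F}$ such that $\varepsilon\le\eta_n$, where $\eta_n=\varepsilon_0n^{-\beta}$; $\int|x|^qf(x)\,dx\le A^q$; and the smoothness condition $$\limsup_{t\to\infty}\sup_{\sigma\ge1}\{|t|^\alpha|\hat h(t|\sigma)|\}\le A,\qquad \limsup_{t\to\infty}\sup_{\sigma\ge1}\{|t|^{\alpha+1}|\hat h'(t|\sigma)|\}\le A$$ holds. Minimax risk. $R_n^{\varepsilon,a}(\tilde{\mathcal{F}})=\inf_{\hat\varepsilon}\sup_{f\in\tilde{\mathcal{F}}}E[\hat\varepsilon-\varepsilon]^2$,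 the infimum being over all estimators based on $X_1,\dots,X_n$. Estimator. $\hat\varepsilon_n(\gamma)=1-n^{-(1-\gamma)}\sum_{j=1}^n\cos(\sqrt{2\gamma\log n}\,X_j)$.
   Formalization: The limsup smoothness condition is required uniformly over the class, with an arbitrary common modulus T (constants do not depend on T, only "sufficiently large n" does); read separately for each f, the upper bound fails when γ<1/2−β. *)

theory Defs
  imports "HOL-Probability.Probability"
begin

section \<open>Eligible mixture densities\<close>

text \<open>
  \<open>H\<close> is the joint law of the pair \<open>(u, \<sigma>)\<close>, and \<open>h u \<sigma>\<close> stands for the conditional
  density \<open>h(u|\<sigma>)\<close>.
\<close>

definition mix_density :: "real \<Rightarrow> (real \<times> real) measure \<Rightarrow> real \<Rightarrow> real" where
  "mix_density \<epsilon> H x =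
     (1 - \<epsilon>) * std_normal_density x
     + \<epsilon> * (LINT p|H. std_normal_density ((x - fst p) / snd p) / snd p)"

text \<open>
  The last conjunct is the disintegration \<open>dH(u, \<sigma>) = h(u|\<sigma>) du dH(\<sigma>)\<close>, with \<open>H(\<sigma>)\<close> the
  second marginal of \<open>H\<close>. Values \<open>h u \<sigma>\<close> with \<open>\<sigma> < 1\<close> are irrelevant.
\<close>

definition eligible :: "real \<Rightarrow> (real \<times> real) measure \<Rightarrow> (real \<Rightarrow> real \<Rightarrow> real) \<Rightarrow> bool" where
  "eligible \<epsilon> H h \<longleftrightarrow>
     0 < \<epsilon> \<and> \<epsilon> < 1 \<and>
     prob_space H \<and> sets H = sets (borel \<Otimes>\<^sub>M borel) \<and>
     (AE p in H. 1 \<le> snd p) \<and>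
     (\<lambda>p. h (fst p) (snd p)) \<in> borel_measurable (borel \<Otimes>\<^sub>M borel) \<and>
     (\<forall>\<sigma>\<ge>1. (\<forall>u. 0 \<le> h u \<sigma>) \<and> (\<integral>\<^sup>+ u. ennreal (h u \<sigma>) \<partial>lborel) = 1) \<and>
     H = density (lborel \<Otimes>\<^sub>M distr H borel snd) (\<lambda>p. ennreal (h (fst p) (snd p)))"


section \<open>The smoothness condition\<close>

definition hhat :: "(real \<Rightarrow> real \<Rightarrow> real) \<Rightarrow> real \<Rightarrow> real \<Rightarrow> complex" where
  "hhat h \<sigma> t = (LINT u|lborel. iexp (t * u) * complex_of_real (h u \<sigma>))"

definition hhat' :: "(real \<Rightarrow> real \<Rightarrow> real) \<Rightarrow> real \<Rightarrow> real \<Rightarrow> complex" where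
  "hhat' h \<sigma> t = vector_derivative (hhat h \<sigma>) (at t)"

definition smooth_cond :: "real \<Rightarrow> real \<Rightarrow> (real \<Rightarrow> real \<Rightarrow> real) \<Rightarrow> bool" where
  "smooth_cond \<alpha> A h \<longleftrightarrow>
     (\<forall>\<sigma>\<ge>1. \<forall>t. hhat h \<sigma> differentiable (at t)) \<and>
     Limsup at_top (\<lambda>t::real. SUP \<sigma>\<in>{1..}. ereal (\<bar>t\<bar> powr \<alpha> * cmod (hhat h \<sigma> t))) \<le> ereal A \<and>
     Limsup at_top (\<lambda>t::real. SUP \<sigma>\<in>{1..}. ereal (\<bar>t\<bar> powr (\<alpha> + 1) * cmod (hhat' h \<sigma> t))) \<le> ereal A"

text \<open>
  Over all \<open>h\<close> satisfying \<open>smooth_cond\<close> the two upper limits are not uniform: rescaling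
  \<open>u\<close> towards \<open>0\<close> keeps the condition but makes \<open>hhat h \<sigma> t\<close> close to \<open>1\<close> at any prescribed
  \<open>t\<close>. Maximal risks are therefore taken over classes on which the upper limits hold
  uniformly. The function \<open>T\<close> is a common modulus: from \<open>T \<delta>\<close> on, the bound \<open>A + \<delta>\<close> holds.
\<close>

definition limsup_modulus ::
  "(real \<Rightarrow> real) \<Rightarrow> real \<Rightarrow> real \<Rightarrow> (real \<Rightarrow> real \<Rightarrow> real) \<Rightarrow> bool" where
  "limsup_modulus T \<alpha> A h \<longleftrightarrow>
     (\<forall>\<delta>>0. \<forall>t\<ge>T \<delta>. \<forall>\<sigma>\<ge>1.
        \<bar>t\<bar> powr \<alpha> * cmod (hhat h \<sigma> t) \<le> A + \<delta> \<and>
        \<bar>t\<bar> powr (\<alpha> + 1) * cmod (hhat' h \<sigma> t) \<le> A + \<delta>)"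

lemma Limsup_SUP_le_iff_modulus:
  fixes g :: "real \<Rightarrow> real \<Rightarrow> real"
  assumes "S \<noteq> {}"
  shows "Limsup at_top (\<lambda>t::real. SUP \<sigma>\<in>S. ereal (g \<sigma> t)) \<le> ereal A \<longleftrightarrow>
         (\<forall>\<delta>>0. \<exists>T. \<forall>t\<ge>T. \<forall>\<sigma>\<in>S. g \<sigma> t \<le> A + \<delta>)"
    (is "?L \<longleftrightarrow> ?R")
proof
  assume L: ?L
  show ?R
  proof (intro allI impI)
    fix \<delta> :: real assume "\<delta> > 0"
    then have "ereal A < ereal (A + \<delta>)" by simp
    with L have "eventually (\<lambda>t. (SUP \<sigma>\<in>S. ereal (g \<sigma> t)) < ereal (A + \<delta>)) at_top"
      by (auto simp: Limsup_le_iff)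
    then obtain T where T: "\<And>t. t \<ge> T \<Longrightarrow> (SUP \<sigma>\<in>S. ereal (g \<sigma> t)) < ereal (A + \<delta>)"
      by (auto simp: eventually_at_top_linorder)
    have "g \<sigma> t \<le> A + \<delta>" if "t \<ge> T" "\<sigma> \<in> S" for t \<sigma>
    proof -
      have "ereal (g \<sigma> t) \<le> (SUP \<sigma>\<in>S. ereal (g \<sigma> t))" using that by (intro SUP_upper)
      also have "\<dots> < ereal (A + \<delta>)" using T that by simp
      finally show ?thesis by simp
    qed
    then show "\<exists>T. \<forall>t\<ge>T. \<forall>\<sigma>\<in>S. g \<sigma> t \<le> A + \<delta>" by blast
  qed
next
  assume R: ?R
  show ?L
  proof (rule ereal_le_epsilon2)
    fix \<delta> :: real assume "\<delta> > 0"
    with R obtain T where "\<And>t \<sigma>. t \<ge> T \<Longrightarrow> \<sigma> \<in> S \<Longrightarrow> g \<sigma> t \<le> A + \<delta>" by blast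
    then have "eventually (\<lambda>t. (SUP \<sigma>\<in>S. ereal (g \<sigma> t)) \<le> ereal (A + \<delta>)) at_top"
      unfolding eventually_at_top_linorder by (intro exI[of _ T]) (auto intro!: SUP_least)
    then show "Limsup at_top (\<lambda>t. SUP \<sigma>\<in>S. ereal (g \<sigma> t)) \<le> ereal A + ereal \<delta>"
      by (auto intro: Limsup_bounded)
  qed
qed

lemma smooth_cond_iff_modulus:
  "smooth_cond \<alpha> A h \<longleftrightarrow>
     (\<forall>\<sigma>\<ge>1. \<forall>t. hhat h \<sigma> differentiable (at t)) \<and> (\<exists>T. limsup_modulus T \<alpha> A h)"
proof -
  have "(\<exists>T. limsup_modulus T \<alpha> A h) \<longleftrightarrow>
     (\<forall>\<delta>>0. \<exists>T. \<forall>t\<ge>T. \<forall>\<sigma>\<in>{1..}. \<bar>t\<bar> powr \<alpha> * cmod (hhat h \<sigma> t) \<le> A + \<delta>) \<and>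
     (\<forall>\<delta>>0. \<exists>T. \<forall>t\<ge>T. \<forall>\<sigma>\<in>{1..}. \<bar>t\<bar> powr (\<alpha> + 1) * cmod (hhat' h \<sigma> t) \<le> A + \<delta>)"
    (is "?E \<longleftrightarrow> ?P \<and> ?Q")
  proof
    assume ?E then show "?P \<and> ?Q" unfolding limsup_modulus_def by (meson atLeast_iff)
  next
    assume pq: "?P \<and> ?Q"
    from pq obtain T1 where T1: "\<And>\<delta> t \<sigma>. \<delta> > 0 \<Longrightarrow> t \<ge> T1 \<delta> \<Longrightarrow> \<sigma> \<in> {1..} \<Longrightarrow>
        \<bar>t\<bar> powr \<alpha> * cmod (hhat h \<sigma> t) \<le> A + \<delta>" by metis
    from pq obtain T2 where T2: "\<And>\<delta> t \<sigma>. \<delta> > 0 \<Longrightarrow> t \<ge> T2 \<delta> \<Longrightarrow> \<sigma> \<in> {1..} \<Longrightarrow>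
        \<bar>t\<bar> powr (\<alpha> + 1) * cmod (hhat' h \<sigma> t) \<le> A + \<delta>" by metis
    have "limsup_modulus (\<lambda>\<delta>. max (T1 \<delta>) (T2 \<delta>)) \<alpha> A h"
      unfolding limsup_modulus_def using T1 T2 by simp
    then show ?E by blast
  qed
  then show ?thesis
    unfolding smooth_cond_def by (simp add: Limsup_SUP_le_iff_modulus)
qed


section \<open>Parameter spaces\<close>

text \<open>
  Elements are pairs \<open>(\<epsilon>, f)\<close> of a density and its proportion; \<open>\<epsilon>\<close> is a function of \<open>f\<close> by
  identifiability. \<open>in_class\<close> collects all requirements except those on smoothness.
\<close>

definition in_class ::
  "real \<Rightarrow> real \<Rightarrow> real \<Rightarrow> real \<Rightarrow> nat \<Rightarrow> real \<Rightarrow> (real \<times> real) measure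
    \<Rightarrow> (real \<Rightarrow> real \<Rightarrow> real) \<Rightarrow> bool" where
  "in_class \<beta> \<epsilon>0 q A n \<epsilon> H h \<longleftrightarrow>
     eligible \<epsilon> H h \<and>
     \<epsilon> \<le> \<epsilon>0 * real n powr (- \<beta>) \<and>
     (\<integral>\<^sup>+ x. ennreal (\<bar>x\<bar> powr q * mix_density \<epsilon> H x) \<partial>lborel) \<le> ennreal (A powr q)"

definition Ftilde ::
  "real \<Rightarrow> real \<Rightarrow> real \<Rightarrow> real \<Rightarrow> real \<Rightarrow> nat \<Rightarrow> (real \<times> (real \<Rightarrow> real)) set" where
  "Ftilde \<alpha> \<beta> \<epsilon>0 q A n =
     {(\<epsilon>, mix_density \<epsilon> H) | \<epsilon> H h. in_class \<beta> \<epsilon>0 q A n \<epsilon> H h \<and> smooth_cond \<alpha> A h}"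

definition Ftilde_unif ::
  "(real \<Rightarrow> real) \<Rightarrow> real \<Rightarrow> real \<Rightarrow> real \<Rightarrow> real \<Rightarrow> real \<Rightarrow> nat \<Rightarrow> (real \<times> (real \<Rightarrow> real)) set" where
  "Ftilde_unif T \<alpha> \<beta> \<epsilon>0 q A n =
     {(\<epsilon>, mix_density \<epsilon> H) | \<epsilon> H h.
        in_class \<beta> \<epsilon>0 q A n \<epsilon> H h \<and> smooth_cond \<alpha> A h \<and> limsup_modulus T \<alpha> A h}"

lemma Ftilde_eq_Union: "Ftilde \<alpha> \<beta> \<epsilon>0 q A n = (\<Union>T. Ftilde_unif T \<alpha> \<beta> \<epsilon>0 q A n)"
  unfolding Ftilde_def Ftilde_unif_def
  using smooth_cond_iff_modulus by (auto simp: set_eq_iff)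


section \<open>Risks\<close>

text \<open>The observations \<open>X\<^sub>1, \<dots>, X\<^sub>n\<close> are the coordinates \<open>X 1, \<dots>, X n\<close>. Risks may be infinite.\<close>

definition sample :: "(real \<Rightarrow> real) \<Rightarrow> nat \<Rightarrow> (nat \<Rightarrow> real) measure" where
  "sample f n = (\<Pi>\<^sub>M i\<in>{1..n}. density lborel (\<lambda>x. ennreal (f x)))"

definition max_risk ::
  "(real \<times> (real \<Rightarrow> real)) set \<Rightarrow> nat \<Rightarrow> ((nat \<Rightarrow> real) \<Rightarrow> real) \<Rightarrow> ennreal" where
  "max_risk \<F> n est = (SUP (\<epsilon>, f)\<in>\<F>. \<integral>\<^sup>+ X. ennreal ((est X - \<epsilon>)\<^sup>2) \<partial>sample f n)"

definition minimax_risk :: "(real \<times> (real \<Rightarrow> real)) set \<Rightarrow> nat \<Rightarrow> ennreal" where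
  "minimax_risk \<F> n =
     (INF est\<in>borel_measurable (\<Pi>\<^sub>M i\<in>{1..n}. borel). max_risk \<F> n est)"

definition eps_hat :: "real \<Rightarrow> nat \<Rightarrow> (nat \<Rightarrow> real) \<Rightarrow> real" where
  "eps_hat \<gamma> n X =
     1 - real n powr (- (1 - \<gamma>)) * (\<Sum>j=1..n. cos (sqrt (2 * \<gamma> * ln (real n)) * X j))"

definition abs_moment :: "real \<Rightarrow> real" where
  "abs_moment q = (LINT x|lborel. std_normal_density x * \<bar>x\<bar> powr q)"

definition opt_rate :: "real \<Rightarrow> real \<Rightarrow> nat \<Rightarrow> real" where
  "opt_rate \<alpha> \<beta> n = real n powr (- 2 * \<beta>) * ln (real n) powr (- \<alpha>)"

end

theory Submission
  imports Defs "HOL-Real_Asymp.Real_Asymp"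
begin

text \<open>
  At the frequency \<open>t = sqrt (2 * \<gamma> * ln n)\<close> the characteristic function of the null component
  is \<open>exp (- t\<^sup>2 / 2) = n powr (- \<gamma>)\<close>, and the one of a mixture is
  \<open>(1 - \<epsilon>) * exp (- t\<^sup>2 / 2)\<close> plus \<open>\<epsilon>\<close> times the mean of
  \<open>exp (- (\<sigma> * t)\<^sup>2 / 2) * hhat h \<sigma> t\<close> over \<open>\<sigma>\<close>. Since \<open>\<sigma> \<ge> 1\<close>, the Gaussian factor
  in the second term is at most \<open>exp (- t\<^sup>2 / 2)\<close>, so multiplying by \<open>n powr \<gamma>\<close> isolates
  \<open>1 - \<epsilon>\<close> up to a bias of order \<open>\<epsilon> * t powr (- \<alpha>)\<close>. Its square is at most of the
  order of the rate \<open>n powr (- 2 * \<beta>) * ln n powr (- \<alpha>)\<close>; the variance of a mean of \<open>n\<close> cosines times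
  \<open>n powr \<gamma>\<close> is at most \<open>n powr (2 * \<gamma> - 1)\<close>. This is \<open>nn_integral_eps_hat_le\<close>.

  The lower bound compares two mixtures, all of whose components have scale \<open>1\<close>, and whose
  proportions differ by a constant times \<open>n powr (- \<beta>) * \<tau> powr (- \<alpha>)\<close> with
  \<open>\<tau>\<^sup>2 = 12 * ln n\<close>. There are two nonnegative kernels \<open>K1\<close> and \<open>K2\<close> with compactly
  supported Fourier transforms, in \<open>[-R, R]\<close> say, whose difference has transform \<open>1\<close> on \<open>[-1, 1]\<close>
  (\<open>exists_band_kernels\<close>). Both mixing densities consist of a common part of mass of order
  \<open>n powr (- \<beta>)\<close> and of a spike: \<open>K1\<close>, respectively \<open>K2\<close>, compressed by the factor
  \<open>\<tau>\<close>, with a mass smaller than that of the common part by a factor of order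
  \<open>\<tau> powr (- \<alpha>)\<close>. Compression dilates the support of the transform to \<open>\<bar>t\<bar> \<le> R * \<tau>\<close>,
  where a weight \<open>\<tau> powr (- \<alpha>)\<close> is just what \<open>\<bar>t\<bar> powr \<alpha>\<close> allows. The difference of the two
  observed densities is a multiple of \<open>\<phi> * (K1 - K2) - \<phi>\<close>, where the star is convolution and
  \<open>K1 - K2\<close> is compressed; its transform vanishes for \<open>\<bar>t\<bar> \<le> \<tau>\<close> because of the value \<open>1\<close>
  there. Hence the difference is of order \<open>exp (- \<tau>\<^sup>2 / 4) = n powr (- 3)\<close> uniformly, and,
  with the bound on the \<open>q\<close>-th moments and \<open>q \<ge> 2\<close>, of order \<open>n powr (- 2)\<close> in \<open>L\<^sup>1\<close>.
  Samples of size \<open>n\<close> then cannot tell the two mixtures apart (\<open>two_point_lower_bound\<close>), and no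
  estimator does better than a constant times the squared distance of the proportions.

  The common part is spread out so widely that the smoothness bounds hold for all \<open>t\<close>, not only
  in the limit. The two mixtures therefore lie in the class for every modulus \<open>T\<close>, which makes
  the constant independent of \<open>T\<close>.
\<close>

section \<open>Fourier transforms of integrable functions\<close>

definition fourier :: "(real \<Rightarrow> real) \<Rightarrow> real \<Rightarrow> complex" where
  "fourier F t = (LINT u|lborel. iexp (t * u) * complex_of_real (F u))"

lemma integrable_iexp_times:
  fixes F :: "real \<Rightarrow> real"
  assumes "integrable lborel F"
  shows "integrable lborel (\<lambda>u. iexp (t * u) * complex_of_real (F u))"
  by (rule Bochner_Integration.integrable_bound[OF assms])
     (use assms in \<open>auto simp: norm_mult dest: borel_measurable_integrable\<close>)

lemma fourier_add:
  assumes "integrable lborel F" "integrable lborel G"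
  shows "fourier (\<lambda>x. a * F x + b * G x) t = a * fourier F t + b * fourier G t"
proof -
  note * = integrable_iexp_times
  have "fourier (\<lambda>x. a * F x + b * G x) t =
     (LINT u|lborel. a * (iexp (t * u) * complex_of_real (F u)) + b * (iexp (t * u) * complex_of_real (G u)))"
    unfolding fourier_def by (simp add: algebra_simps)
  also have "\<dots> = a * fourier F t + b * fourier G t"
    unfolding fourier_def
    by (simp only: Bochner_Integration.integral_add[OF integrable_mult_right[OF *[OF assms(1)]] integrable_mult_right[OF *[OF assms(2)]]]
          integral_mult_right_zero)
  finally show ?thesis .
qed

lemma fourier_zero: "integrable lborel k \<Longrightarrow> fourier k 0 = complex_of_real (LINT u|lborel. k u)"
  unfolding fourier_def by simp

lemma fourier_measurable [measurable]:
  assumes [measurable]: "k \<in> borel_measurable borel"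
  shows "fourier k \<in> borel_measurable borel"
  unfolding fourier_def by measurable

lemma norm_fourier_le: "cmod (fourier F t) \<le> (LINT u|lborel. \<bar>F u\<bar>)"
proof -
  have "cmod (fourier F t) \<le> (LINT u|lborel. cmod (iexp (t * u) * complex_of_real (F u)))"
    unfolding fourier_def by (rule integral_norm_bound)
  then show ?thesis by (simp add: norm_mult)
qed

lemma norm_iexp_diff_le: "cmod (iexp a - iexp b) \<le> \<bar>a - b\<bar>"
proof -
  have "iexp a - iexp b = iexp b * (iexp (a - b) - 1)"
    by (simp add: algebra_simps flip: exp_add)
  then have "cmod (iexp a - iexp b) = cmod (iexp (a - b) - 1)"
    by (simp add: norm_mult)
  also have "\<dots> \<le> \<bar>a - b\<bar>" using iexp_approx1[of "a - b" 0] by simp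
  finally show ?thesis .
qed

text \<open>
  Differentiation under the integral sign: the difference quotients of \<open>iexp (t * u)\<close> in \<open>t\<close>
  are bounded by \<open>\<bar>u\<bar>\<close>, so a multiple of \<open>\<bar>u * F u\<bar>\<close> dominates.
\<close>

lemma has_vector_derivative_fourier:
  assumes F: "integrable lborel F" and uF: "integrable lborel (\<lambda>u. u * F u)"
  shows "(fourier F has_vector_derivative (LINT u|lborel. \<i> * (iexp (t * u) * complex_of_real (u * F u)))) (at t)"
proof -
  define D where "D = (LINT u|lborel. \<i> * (iexp (t * u) * complex_of_real (u * F u)))"
  define E where "E h u = (iexp ((t + h) * u) - iexp (t * u) - h *\<^sub>R (\<i> * u * iexp (t * u))) * complex_of_real (F u)" for h u
  have iD: "integrable lborel (\<lambda>u. \<i> * (iexp (t * u) * complex_of_real (u * F u)))"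
    by (intro integrable_mult_right integrable_iexp_times uF)
  have E_int: "integrable lborel (E h)" 
    and E: "fourier F (t + h) - fourier F t - h *\<^sub>R D = (LINT u|lborel. E h u)" for h
  proof -
    have eq: "E h = (\<lambda>u. iexp ((t + h) * u) * complex_of_real (F u) - iexp (t * u) * complex_of_real (F u)
         - h *\<^sub>R (\<i> * (iexp (t * u) * complex_of_real (u * F u))))"
      by (rule ext) (simp add: E_def algebra_simps scaleR_conv_of_real)
    show "integrable lborel (E h)"
      unfolding eq
      by (intro Bochner_Integration.integrable_diff integrable_scaleR_right iD integrable_iexp_times F)
    show "fourier F (t + h) - fourier F t - h *\<^sub>R D = (LINT u|lborel. E h u)"
      unfolding eq fourier_def D_def
      by (simp only: Bochner_Integration.integral_diff[OF Bochner_Integration.integrable_diff[OF integrable_iexp_times[OF F] integrable_iexp_times[OF F]] integrable_scaleR_right[OF iD]]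
        Bochner_Integration.integral_diff[OF integrable_iexp_times[OF F] integrable_iexp_times[OF F]] integral_scaleR_right)
  qed
  have lim: "((\<lambda>h. cmod (LINT u|lborel. E h u) / \<bar>h\<bar>) \<longlongrightarrow> 0) (at 0)"
    unfolding tendsto_at_iff_sequentially comp_def
  proof (intro allI impI)
    fix X :: "nat \<Rightarrow> real" assume X: "\<forall>i. X i \<in> UNIV - {0}" and X0: "X \<longlonglongrightarrow> 0"
    have "(\<lambda>n. LINT u|lborel. E (X n) u /\<^sub>R X n) \<longlonglongrightarrow> (LINT u::real|lborel. (0::complex))"
    proof (rule integral_dominated_convergence[where s="\<lambda>n u. E (X n) u /\<^sub>R X n" and f="\<lambda>_. 0"
          and w="\<lambda>u. 2 * \<bar>u * F u\<bar>"])
      show "AE u in lborel. (\<lambda>n. E (X n) u /\<^sub>R X n) \<longlonglongrightarrow> 0"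
      proof (rule AE_I2)
        fix u
        have "((\<lambda>s. iexp (s * u)) has_vector_derivative (\<i> * u * iexp (t * u))) (at t)"
          by (auto intro!: derivative_eq_intros simp: has_vector_derivative_complex_iff Re_exp Im_exp
               simp flip: has_real_derivative_iff_has_vector_derivative)
        then have "((\<lambda>h. cmod (iexp ((t + h) * u) - iexp (t * u) - h *\<^sub>R (\<i> * u * iexp (t * u))) / \<bar>h\<bar>) \<longlongrightarrow> 0) (at 0)"
          by (simp add: has_vector_derivative_def has_derivative_at)
        then have "(\<lambda>n. cmod (iexp ((t + X n) * u) - iexp (t * u) - X n *\<^sub>R (\<i> * u * iexp (t * u))) / \<bar>X n\<bar>) \<longlonglongrightarrow> 0"
          using X X0 unfolding tendsto_at_iff_sequentially comp_def by blast
        then have "(\<lambda>n. cmod (iexp ((t + X n) * u) - iexp (t * u) - X n *\<^sub>R (\<i> * u * iexp (t * u))) / \<bar>X n\<bar> * \<bar>F u\<bar>) \<longlonglongrightarrow> 0"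
          by (rule tendsto_mult_left_zero)
        moreover have "cmod (iexp ((t + h) * u) - iexp (t * u) - h *\<^sub>R (\<i> * u * iexp (t * u))) / \<bar>h\<bar> * \<bar>F u\<bar> = cmod (E h u /\<^sub>R h)" for h
          by (simp add: E_def norm_mult divide_inverse mult_ac)
        ultimately show "(\<lambda>n. E (X n) u /\<^sub>R X n) \<longlonglongrightarrow> 0"
          by (simp only: tendsto_norm_zero_iff)
      qed
      show "AE u in lborel. cmod (E (X n) u /\<^sub>R X n) \<le> 2 * \<bar>u * F u\<bar>" for n
      proof (rule AE_I2)
        fix u
        have n0: "X n \<noteq> 0" using X by simp
        define c where "c = cmod (iexp ((t + X n) * u) - iexp (t * u) - X n *\<^sub>R (\<i> * u * iexp (t * u)))"
        have "c \<le> cmod (iexp ((t + X n) * u) - iexp (t * u)) + cmod (X n *\<^sub>R (\<i> * u * iexp (t * u)))"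
          unfolding c_def by (rule norm_triangle_ineq4)
        also have "\<dots> \<le> \<bar>(t + X n) * u - t * u\<bar> + \<bar>X n\<bar> * \<bar>u\<bar>"
          by (intro add_mono norm_iexp_diff_le) (simp add: norm_mult)
        also have "(t + X n) * u - t * u = X n * u" by (simp add: algebra_simps)
        finally have c: "c \<le> 2 * (\<bar>X n\<bar> * \<bar>u\<bar>)" by (simp add: abs_mult mult_ac)
        have "cmod (E (X n) u /\<^sub>R X n) = c * \<bar>F u\<bar> / \<bar>X n\<bar>"
          by (simp add: E_def c_def norm_mult divide_inverse mult_ac)
        also have "\<dots> \<le> 2 * (\<bar>X n\<bar> * \<bar>u\<bar>) * \<bar>F u\<bar> / \<bar>X n\<bar>"
          by (intro divide_right_mono mult_right_mono c) auto
        finally show "cmod (E (X n) u /\<^sub>R X n) \<le> 2 * \<bar>u * F u\<bar>"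
          using n0 by (simp add: abs_mult)
      qed
      show "integrable lborel (\<lambda>u. 2 * \<bar>u * F u\<bar>)" using uF by simp
      show "(\<lambda>u. E (X n) u /\<^sub>R X n) \<in> borel_measurable lborel" for n
        using E_int by (intro borel_measurable_scaleR) (auto dest: borel_measurable_integrable)
    qed simp
    then have "(\<lambda>n. cmod ((LINT u|lborel. E (X n) u) /\<^sub>R X n)) \<longlonglongrightarrow> 0"
      by (intro tendsto_norm_zero) simp
    then show "(\<lambda>n. cmod (LINT u|lborel. E (X n) u) / \<bar>X n\<bar>) \<longlonglongrightarrow> 0"
      by (simp add: divide_inverse mult.commute)
  qed
  show ?thesis
    unfolding has_vector_derivative_def has_derivative_at
    using lim by (simp add: E[symmetric] D_def bounded_linear_scaleR_left)
qed

lemma norm_vector_derivative_fourier_le: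
  assumes F: "integrable lborel F" and uF: "integrable lborel (\<lambda>u. u * F u)"
  shows "cmod (vector_derivative (fourier F) (at t)) \<le> (LINT u|lborel. \<bar>u * F u\<bar>)"
proof -
  have "vector_derivative (fourier F) (at t) = (LINT u|lborel. \<i> * (iexp (t * u) * complex_of_real (u * F u)))"
    by (rule vector_derivative_at[OF has_vector_derivative_fourier[OF assms]])
  also have "cmod \<dots> \<le> (LINT u|lborel. cmod (\<i> * (iexp (t * u) * complex_of_real (u * F u))))"
    by (rule integral_norm_bound)
  finally show ?thesis by (simp add: norm_mult abs_mult)
qed

section \<open>Nonnegative kernels with band-limited transforms\<close>

text \<open>
  The exponent \<open>p\<close> is the order of the highest moment that is needed, and \<open>R\<close> is the
  bandwidth.
\<close>

definition band_kernel :: "nat \<Rightarrow> real \<Rightarrow> (real \<Rightarrow> real) \<Rightarrow> bool" where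
  "band_kernel p R K \<longleftrightarrow>
     (\<forall>x. 0 \<le> K x) \<and> integrable lborel K \<and> integrable lborel (\<lambda>x. \<bar>x\<bar> ^ p * K x) \<and>
     (\<forall>t. R \<le> \<bar>t\<bar> \<longrightarrow> fourier K t = 0)"

lemma char_uniform:
  assumes "x \<noteq> 0"
  shows "char (uniform_measure lborel {-1..1}) x = complex_of_real (sin x / x)"
proof -
  have "char (uniform_measure lborel {-1..1}) x = (CLINT y|density lborel (\<lambda>y. ennreal (indicator {-1..1} y / 2)). iexp (x * y))"
    unfolding char_def uniform_measure_def
    by (intro arg_cong2[where f="lebesgue_integral"] density_cong AE_I2 refl)
       (auto simp: indicator_def divide_ennreal[of 1 2, simplified])
  also have "\<dots> = (CLINT y|lborel. indicator {-1..1} y *\<^sub>R (iexp (x * y) / 2))"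
    by (subst integral_density) (auto intro!: Bochner_Integration.integral_cong simp: indicator_def scaleR_conv_of_real)
  also have "\<dots> = iexp (x * 1) / (2 * \<i> * x) - iexp (x * (-1)) / (2 * \<i> * x)"
  proof (rule has_bochner_integral_integral_eq, rule has_bochner_integral_FTC_Icc)
    fix y
    have "((\<lambda>y. iexp (x * y)) has_vector_derivative (\<i> * x) * iexp (x * y)) (at y within {-1..1})"
      by (auto intro!: derivative_eq_intros simp: has_vector_derivative_complex_iff Re_exp Im_exp
               simp flip: has_real_derivative_iff_has_vector_derivative)
    from has_vector_derivative_divide[OF this, of "2 * \<i> * x"]
    show "((\<lambda>y. iexp (x * y) / (2 * \<i> * x)) has_vector_derivative (iexp (x * y) / 2)) (at y within {-1..1})"
      using assms by simp
  qed (auto intro!: continuous_intros)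
  also have "\<dots> = complex_of_real (sin x / x)"
    using assms by (simp add: complex_eq_iff Re_exp Im_exp Re_divide Im_divide power2_eq_square)
  finally show ?thesis .
qed

text \<open>
  The law of a sum of \<open>m\<close> independent uniform variables on \<open>[-1, 1]\<close>. Its characteristic
  function decays polynomially while its support is bounded, which is what produces integrable
  band-limited kernels. The characteristic function is stated for \<open>x \<noteq> 0\<close> only, since
  \<open>sin 0 / 0 = 0\<close> differs from the limit \<open>1\<close>.
\<close>

lemma uniform_sum_distribution:
  "\<exists>M. real_distribution M \<and> (\<forall>x. x \<noteq> 0 \<longrightarrow> char M x = complex_of_real ((sin x / x) ^ m))
     \<and> measure M {- real m..real m} = 1"
proof (induction m)
  case 0
  have "real_distribution (return borel (0::real))"
    by (simp add: real_distribution_def real_distribution_axioms_def prob_space_return)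
  moreover have "char (return borel (0::real)) x = 1" for x
    unfolding char_def by (subst integral_return) auto
  moreover have "measure (return borel (0::real)) {0..0} = 1"
    by (subst measure_return) auto
  ultimately show ?case by (intro exI[of _ "return borel 0"]) auto
next
  case (Suc m)
  then obtain M where M: "real_distribution M"
    and ch: "\<And>x. x \<noteq> 0 \<Longrightarrow> char M x = complex_of_real ((sin x / x) ^ m)"
    and supp: "measure M {- real m..real m} = 1" by blast
  define U where "U = uniform_measure lborel {-1..1::real}"
  have U: "prob_space U" unfolding U_def by (rule prob_space_uniform_measure) auto
  have [measurable_cong]: "sets U = sets borel" unfolding U_def by simp
  interpret M: real_distribution M by fact
  interpret U: prob_space U by fact
  interpret P: pair_prob_space M U ..
  have [measurable_cong]: "sets M = sets borel" by simp
  define N where "N = distr (M \<Otimes>\<^sub>M U) borel (\<lambda>(x,y). x + y)"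
  have N: "real_distribution N"
    unfolding N_def by (intro real_distribution.intro P.prob_space_distr real_distribution_axioms.intro) auto
  have "char N x = complex_of_real ((sin x / x) ^ Suc m)" if "x \<noteq> 0" for x
  proof -
    have "char N x = (CLINT z|M \<Otimes>\<^sub>M U. iexp (x * fst z) * iexp (x * snd z))"
      unfolding char_def N_def
      by (subst integral_distr) (auto simp: case_prod_beta algebra_simps exp_add)
    also have "\<dots> = (CLINT y|M. (CLINT z|U. iexp (x * y) * iexp (x * z)))"
      by (subst P.integral_fst'[symmetric])
         (auto intro!: P.integrable_const_bound[where B=1] simp: norm_mult)
    also have "\<dots> = char M x * char U x"
      by (simp add: char_def)
    finally show ?thesis using that ch char_uniform[OF that] by (simp add: U_def mult.commute)
  qed
  moreover have "measure N {- real (Suc m)..real (Suc m)} = 1"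
  proof -
    interpret N: real_distribution N by fact
    have aeM: "AE x in M. x \<in> {- real m..real m}"
      by (rule M.AE_prob_1[OF supp])
    have aeU: "AE y in U. y \<in> {-1..1}"
      unfolding U_def by (intro AE_uniform_measureI) auto
    have "AE z in M \<Otimes>\<^sub>M U. fst z \<in> {- real m..real m} \<and> snd z \<in> {-1..1}"
    proof (rule P.AE_pair_measure)
      show "AE x in M. AE y in U. fst (x, y) \<in> {- real m..real m} \<and> snd (x, y) \<in> {-1..1}"
        using aeM by eventually_elim (use aeU in simp)
    qed measurable
    then have "AE x in N. x \<in> {- real (Suc m)..real (Suc m)}"
      unfolding N_def
    proof (subst AE_distr_iff)
      assume "AE z in M \<Otimes>\<^sub>M U. fst z \<in> {- real m..real m} \<and> snd z \<in> {-1..1}"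
      then show "AE z in M \<Otimes>\<^sub>M U. (case z of (x, y) \<Rightarrow> x + y) \<in> {- real (Suc m)..real (Suc m)}"
        by eventually_elim auto
    qed measurable
    then show ?thesis by (subst N.prob_eq_1) auto
  qed
  ultimately show ?case using N by blast
qed

text \<open>
  Multiplying a characteristic function by \<open>sin (a * x) / (pi * x)\<close> and transforming gives the
  mass of a window of half-width \<open>a\<close>: the Levy inversion formula read as a statement on the
  transform of an integrable function. The window endpoints are kept off the support of \<open>M\<close>, which
  makes them null sets.
\<close>

lemma fourier_sinc_mult_char:
  assumes "real_distribution M"
    and supp: "measure M {-r..r} = 1"
    and "a \<ge> 0" "r < \<bar>t - a\<bar>" "r < \<bar>t + a\<bar>"
    and F: "\<And>x. complex_of_real (F x) = complex_of_real (sin (a * x) / (pi * x)) * char M x"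
    and int: "integrable lborel F"
  shows "fourier F t = measure M {-t - a<..-t + a}"
proof -
  interpret real_distribution M by fact
  have null: "measure M {b} = 0" if "r < \<bar>b\<bar>" for b
  proof -
    have "measure M {-r..r} + measure M {b} = measure M ({-r..r} \<union> {b})"
      using that by (subst finite_measure_Union) auto
    also have "\<dots> \<le> 1" by simp
    finally show ?thesis using supp measure_nonneg[of M "{b}"] by linarith
  qed
  have "\<bar>-t - a\<bar> = \<bar>t + a\<bar>" "\<bar>-t + a\<bar> = \<bar>t - a\<bar>" by auto
  then have na: "measure M {-t - a} = 0" "measure M {-t + a} = 0"
    using assms(4,5) by (auto intro!: null)
  let ?G = "\<lambda>x. iexp (t * x) * complex_of_real (F x)"
  have [measurable]: "F \<in> borel_measurable borel"
    using int by (auto dest: borel_measurable_integrable)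
  have eq: "1 / (2 * pi) * ((iexp (-(x * (-t - a))) - iexp (-(x * (-t + a)))) / (\<i> * x) * char M x) = ?G x" for x
  proof (cases "x = 0")
    case False
    have "iexp (-(x * (-t - a))) - iexp (-(x * (-t + a))) = iexp (t * x) * (iexp (a * x) - iexp (- (a * x)))"
      by (simp add: algebra_simps flip: exp_add)
    also have "iexp (a * x) - iexp (- (a * x)) = 2 * \<i> * sin (a * x)"
      by (simp add: complex_eq_iff Re_exp Im_exp)
    finally show ?thesis using False F[of x] by (simp add: field_simps)
  qed (use F[of x] in simp)
  have G: "integrable lborel ?G"
    by (rule Bochner_Integration.integrable_bound[OF int]) (auto simp: norm_mult)
  have "(\<lambda>T. 1 / (2 * pi) * (CLBINT x=-real T..T. (iexp (-(x * (-t - a))) - iexp (-(x * (-t + a)))) / (\<i> * x) * char M x))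
     \<longlonglongrightarrow> complex_of_real (measure M {-t - a<..-t + a})"
    using Levy_Inversion[of "-t - a" "-t + a", unfolded of_int_minus of_int_of_nat_eq] assms(3) na
    by simp
  moreover have "1 / (2 * pi) * (CLBINT x=-real T..T. (iexp (-(x * (-t - a))) - iexp (-(x * (-t + a)))) / (\<i> * x) * char M x)
      = (CLINT x|lborel. indicator {-real T<..<real T} x *\<^sub>R ?G x)" for T
  proof -
    have "1 / (2 * pi) * (CLBINT x=-real T..T. (iexp (-(x * (-t - a))) - iexp (-(x * (-t + a)))) / (\<i> * x) * char M x)
       = (CLBINT x=-real T..T. 1 / (2 * pi) * ((iexp (-(x * (-t - a))) - iexp (-(x * (-t + a)))) / (\<i> * x) * char M x))"
      by (rule interval_lebesgue_integral_mult_right[symmetric])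
    also have "\<dots> = (CLBINT x=-real T..T. ?G x)"
      by (simp only: eq)
    also have "\<dots> = (CLINT x|lborel. indicator {-real T<..<real T} x *\<^sub>R ?G x)"
      by (simp add: interval_lebesgue_integral_def set_lebesgue_integral_def)
    finally show ?thesis .
  qed
  moreover have "(\<lambda>T. CLINT x|lborel. indicator {-real T<..<real T} x *\<^sub>R ?G x) \<longlonglongrightarrow> (CLINT x|lborel. ?G x)"
  proof (rule integral_dominated_convergence[where w="\<lambda>x. norm (?G x)"])
    show "AE x in lborel. (\<lambda>T. indicator {-real T<..<real T} x *\<^sub>R ?G x) \<longlonglongrightarrow> ?G x"
    proof (rule AE_I2)
      fix x
      have "\<forall>\<^sub>F T in sequentially. real T > \<bar>x\<bar>"
        using filterlim_real_sequentially by (simp add: filterlim_at_top_dense)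
      then have "\<forall>\<^sub>F T in sequentially. ?G x = indicator {-real T<..<real T} x *\<^sub>R ?G x"
        by eventually_elim (auto simp: indicator_def)
      then show "(\<lambda>T. indicator {-real T<..<real T} x *\<^sub>R ?G x) \<longlonglongrightarrow> ?G x"
        by (rule Lim_transform_eventually[OF tendsto_const])
    qed
  qed (use G in \<open>auto simp: indicator_def intro: integrable_norm\<close>)
  ultimately have "(CLINT x|lborel. ?G x) = measure M {-t - a<..-t + a}"
    using LIMSEQ_unique by force
  then show ?thesis by (simp add: fourier_def)
qed

lemma sinc_sq_le: "(sin x / x)\<^sup>2 \<le> 2 * inverse (1 + x\<^sup>2)" for x :: real
proof (cases "x = 0")
  case False
  have "(sin x)\<^sup>2 \<le> 1" by (simp add: abs_square_le_1)
  moreover have "(sin x)\<^sup>2 \<le> x\<^sup>2" using abs_sin_x_le_abs_x by (simp only: abs_le_square_iff)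
  ultimately have "(sin x)\<^sup>2 * (1 + x\<^sup>2) \<le> 2 * x\<^sup>2"
    using mult_right_mono[of "(sin x)\<^sup>2" 1 "x\<^sup>2"] by (simp add: algebra_simps)
  then show ?thesis using False by (simp add: field_simps add_pos_nonneg)
qed simp

lemma integrable_sinc_sq: "integrable lborel (\<lambda>x::real. (sin x / x)\<^sup>2)"
proof (rule Bochner_Integration.integrable_bound)
  show "integrable lborel (\<lambda>x::real. 2 * inverse (1 + x\<^sup>2))"
    using integrable_inverse_1_plus_square by (simp add: set_integrable_def)
qed (use sinc_sq_le in \<open>auto intro!: AE_I2 order_trans[OF sinc_sq_le] simp: add_nonneg_nonneg\<close>)

lemma integrable_power_times_sinc:
  fixes p k :: nat
  assumes "p \<le> k"
  shows "integrable lborel (\<lambda>x::real. \<bar>x\<bar> ^ p * \<bar>sin x / x\<bar> ^ (k + 2))"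
proof (rule Bochner_Integration.integrable_bound[OF integrable_sinc_sq])
  show "AE x::real in lborel. norm (\<bar>x\<bar> ^ p * \<bar>sin x / x\<bar> ^ (k + 2)) \<le> norm ((sin x / x)\<^sup>2)"
  proof (rule AE_I2)
    fix x :: real
    have s: "\<bar>sin x / x\<bar> \<le> 1"
      using abs_sin_x_le_abs_x[of x] by (cases "x = 0") (auto simp: abs_divide)
    have "\<bar>x\<bar> ^ p * \<bar>sin x / x\<bar> ^ k \<le> \<bar>x\<bar> ^ p * \<bar>sin x / x\<bar> ^ p"
      using s assms by (intro mult_left_mono power_decreasing) auto
    also have "\<dots> = \<bar>x * (sin x / x)\<bar> ^ p" by (simp only: abs_mult power_mult_distrib)
    also have "\<dots> \<le> 1" by (intro power_le_one) auto
    finally have "\<bar>x\<bar> ^ p * \<bar>sin x / x\<bar> ^ k \<le> 1" .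
    from mult_right_mono[OF this zero_le_power2[of "sin x / x"]]
    show "norm (\<bar>x\<bar> ^ p * \<bar>sin x / x\<bar> ^ (k + 2)) \<le> norm ((sin x / x)\<^sup>2)"
      by (simp only: real_norm_def abs_mult power_abs abs_idempotent power_add power2_abs mult.assoc mult_1)
  qed
qed measurable

text \<open>
  With \<open>s x = sin x / x\<close> and \<open>m\<close> even, let \<open>K = a / pi * s ^ m\<close> and
  \<open>W x = sin (a * x) / (pi * x) * s x ^ m\<close>. By the inversion formula the transform of \<open>W\<close>
  at \<open>t\<close> is the probability that a sum of \<open>m\<close> uniform variables falls into a window of
  half-width \<open>a\<close> around \<open>- t\<close>. For \<open>a = m + 2\<close> this is \<open>1\<close> for \<open>\<bar>t\<bar> \<le> 1\<close> and
  \<open>0\<close> for large \<open>\<bar>t\<bar>\<close>. The signed kernel \<open>W\<close> is then written as the difference of the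
  nonnegative kernels \<open>K\<close> and \<open>K - W\<close>, using \<open>\<bar>W\<bar> \<le> K\<close>. The transform of \<open>K\<close>
  also vanishes for large \<open>\<bar>t\<bar>\<close>, since one of its \<open>m\<close> factors can play the role of the window.
\<close>

theorem exists_band_kernels:
  fixes p :: nat
  shows "\<exists>K1 K2 R. 0 < R \<and> band_kernel p R K1 \<and> band_kernel p R K2 \<and>
     (\<forall>t. \<bar>t\<bar> \<le> 1 \<longrightarrow> fourier K1 t - fourier K2 t = 1)"
proof -
  define m where "m = 2 * p + 2"
  define a where "a = real m + 2"
  define s where "s x = sin x / x" for x :: real
  define W where "W x = sin (a * x) / (pi * x) * s x ^ m" for x
  define K where "K x = a / pi * s x ^ m" for x
  define R where "R = 2 * real m + 3"
  have [measurable]: "s \<in> borel_measurable borel" unfolding s_def by measurable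
  have [measurable]: "K \<in> borel_measurable borel" "W \<in> borel_measurable borel" unfolding K_def W_def by measurable
  have ev: "even m" by (simp add: m_def)
  have a: "a > 0" by (simp add: a_def)
  have s_nonneg: "s x ^ m \<ge> 0" for x by (rule zero_le_even_power[OF ev])
  have K: "K x \<ge> 0" for x using a s_nonneg[of x] by (simp add: K_def)
  have WK: "\<bar>W x\<bar> \<le> K x" for x
  proof (cases "x = 0")
    case False
    have "\<bar>sin (a * x) / (pi * x)\<bar> \<le> a / pi"
      using False abs_sin_x_le_abs_x[of "a * x"] a by (simp add: abs_mult field_simps)
    then show ?thesis
      using s_nonneg[of x] mult_right_mono by (fastforce simp: W_def K_def abs_mult power_abs[symmetric])
  qed (use K[of 0] in \<open>simp add: W_def\<close>)
  have powK: "integrable lborel (\<lambda>x. \<bar>x\<bar> ^ j * K x)" if "j \<le> 2 * p" for j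
  proof -
    have "\<bar>x\<bar> ^ j * K x = a / pi * (\<bar>x\<bar> ^ j * \<bar>sin x / x\<bar> ^ (2 * p + 2))" for x
      unfolding K_def s_def m_def[symmetric] power_even_abs[OF ev] by simp
    then show ?thesis using integrable_power_times_sinc[OF that] by (simp only: integrable_mult_right)
  qed
  have powKW: "integrable lborel (\<lambda>x. \<bar>x\<bar> ^ j * (K x - W x))" if "j \<le> 2 * p" for j
  proof (rule Bochner_Integration.integrable_bound[OF integrable_mult_right[OF powK[OF that], of 2]])
    have "norm (\<bar>x\<bar> ^ j * (K x - W x)) \<le> norm (2 * (\<bar>x\<bar> ^ j * K x))" for x
    proof -
      have "\<bar>K x - W x\<bar> \<le> 2 * K x" using WK[of x] by linarith
      from mult_left_mono[OF this, of "\<bar>x\<bar> ^ j"] show ?thesis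
        using K[of x] by (simp add: abs_mult mult.left_commute)
    qed
    then show "AE x in lborel. norm (\<bar>x\<bar> ^ j * (K x - W x)) \<le> norm (2 * (\<bar>x\<bar> ^ j * K x))" by simp
  qed measurable
  have intK: "integrable lborel K" using powK[of 0] by simp
  have intW: "integrable lborel W"
    by (rule Bochner_Integration.integrable_bound[OF intK]) (use WK K in \<open>auto intro!: AE_I2\<close>)
  have fK: "fourier K t = 0" if "R \<le> \<bar>t\<bar>" for t
  proof -
    obtain M where M: "real_distribution M"
      and ch: "\<And>x. x \<noteq> 0 \<Longrightarrow> char M x = complex_of_real ((sin x / x) ^ (m - 1))"
      and supp: "measure M {- real (m - 1)..real (m - 1)} = 1"
      using uniform_sum_distribution[of "m - 1"] by blast
    interpret real_distribution M by fact
    have m: "real (m - 1) < real m" by (simp add: m_def)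
    have "fourier (\<lambda>x. K x / a) t = measure M {- t - 1<..- t + 1}"
    proof (rule fourier_sinc_mult_char[OF M supp])
      show "complex_of_real (K x / a) = complex_of_real (sin (1 * x) / (pi * x)) * char M x" for x
      proof (cases "x = 0")
        case False
        have "K x / a = sin x / (pi * x) * (sin x / x) ^ (m - 1)"
          using a by (simp add: K_def s_def m_def field_simps)
        then show ?thesis using ch[OF False] by simp
      qed (simp add: K_def s_def m_def)
    qed (use that m intK in \<open>auto simp: R_def m_def\<close>)
    also have "measure M {- t - 1<..- t + 1} = 0"
    proof -
      have "measure M {- real (m - 1)..real (m - 1)} + measure M {- t - 1<..- t + 1}
          = measure M ({- real (m - 1)..real (m - 1)} \<union> {- t - 1<..- t + 1})"
        using that m by (subst finite_measure_Union) (auto simp: R_def)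
      also have "\<dots> \<le> 1" by simp
      finally show ?thesis using supp measure_nonneg[of M "{- t - 1<..- t + 1}"] by linarith
    qed
    finally have "fourier (\<lambda>x. K x / a) t = 0" by simp
    then show ?thesis using a by (simp add: fourier_def)
  qed
  obtain M where M: "real_distribution M"
    and ch: "\<And>x. x \<noteq> 0 \<Longrightarrow> char M x = complex_of_real ((sin x / x) ^ m)"
    and supp: "measure M {- real m..real m} = 1"
    using uniform_sum_distribution[of m] by blast
  interpret real_distribution M by fact
  have fW: "fourier W t = measure M {- t - a<..- t + a}" if "\<bar>t\<bar> \<le> 1 \<or> R \<le> \<bar>t\<bar>" for t
  proof (rule fourier_sinc_mult_char[OF M supp])
    show "complex_of_real (W x) = complex_of_real (sin (a * x) / (pi * x)) * char M x" for x
      using ch[of x] by (cases "x = 0") (simp_all add: W_def s_def)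
  qed (use that intW a in \<open>auto simp: R_def a_def\<close>)
  have fW1: "fourier W t = 1" if "\<bar>t\<bar> \<le> 1" for t
  proof -
    have "measure M {- real m..real m} \<le> measure M {- t - a<..- t + a}"
      using that by (intro finite_measure_mono) (auto simp: a_def)
    then have "measure M {- t - a<..- t + a} = 1"
      using supp prob_le_1[of "{- t - a<..- t + a}"] by linarith
    then show ?thesis using fW[OF disjI1[OF that]] by simp
  qed
  have fW0: "fourier W t = 0" if "R \<le> \<bar>t\<bar>" for t
  proof -
    have "measure M {- real m..real m} + measure M {- t - a<..- t + a}
        = measure M ({- real m..real m} \<union> {- t - a<..- t + a})"
      using that by (subst finite_measure_Union) (auto simp: R_def a_def)
    also have "\<dots> \<le> 1" by simp
    finally have "measure M {- t - a<..- t + a} = 0"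
      using supp measure_nonneg[of M "{- t - a<..- t + a}"] by linarith
    then show ?thesis using fW[OF disjI2[OF that]] by simp
  qed
  have fKW: "fourier (\<lambda>x. K x - W x) t = fourier K t - fourier W t" for t
    using fourier_add[OF intK intW, of 1 "-1" t] by simp
  have "band_kernel p R K"
    using K intK powK[of p] fK by (auto simp: band_kernel_def)
  moreover have "band_kernel p R (\<lambda>x. K x - W x)"
    using WK powKW[of 0] powKW[of p] fK fW0 by (auto simp: band_kernel_def fKW abs_le_iff)
  ultimately show ?thesis
    by (intro exI[of _ K] exI[of _ "\<lambda>x. K x - W x"] exI[of _ R]) (auto simp: fKW fW1 R_def)
qed

lemma abs_powr_le_1_plus_power:
  fixes x :: real
  assumes "0 \<le> q" "q \<le> real p"
  shows "\<bar>x\<bar> powr q \<le> 1 + \<bar>x\<bar> ^ p"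
proof (cases "\<bar>x\<bar> \<le> 1")
  case True
  then have "\<bar>x\<bar> powr q \<le> 1" using assms by (intro powr_le1) auto
  then show ?thesis by (simp add: add_increasing2)
next
  case False
  then have "\<bar>x\<bar> powr q \<le> \<bar>x\<bar> powr p" using assms by (intro powr_mono) auto
  then show ?thesis using False by (simp add: powr_realpow)
qed

lemma band_kernelD:
  assumes "band_kernel p R K"
  shows "0 \<le> K x" "integrable lborel K" "K \<in> borel_measurable borel"
    "R \<le> \<bar>t\<bar> \<Longrightarrow> fourier K t = 0" 
  using assms by (auto simp: band_kernel_def dest: borel_measurable_integrable)

lemma band_kernel_integrable_powr:
  assumes "band_kernel p R K" "0 \<le> q" "q \<le> real p"
  shows "integrable lborel (\<lambda>x. \<bar>x\<bar> powr q * K x)"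
proof (rule Bochner_Integration.integrable_bound)
  show "integrable lborel (\<lambda>x. K x + \<bar>x\<bar> ^ p * K x)"
    using assms by (simp add: band_kernel_def)
  have "K \<in> borel_measurable borel" by (rule band_kernelD[OF assms(1)])
  then show "(\<lambda>x. \<bar>x\<bar> powr q * K x) \<in> borel_measurable lborel" by simp
  show "AE x in lborel. norm (\<bar>x\<bar> powr q * K x) \<le> norm (K x + \<bar>x\<bar> ^ p * K x)"
  proof (rule AE_I2)
    fix x
    show "norm (\<bar>x\<bar> powr q * K x) \<le> norm (K x + \<bar>x\<bar> ^ p * K x)"
      using mult_right_mono[OF abs_powr_le_1_plus_power[OF assms(2,3), of x] band_kernelD(1)[OF assms(1), of x]]
        band_kernelD(1)[OF assms(1), of x]
      by (simp add: abs_mult algebra_simps)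
  qed
qed

lemma band_kernel_integrable_first_moment:
  assumes "band_kernel p R K" "1 \<le> p"
  shows "integrable lborel (\<lambda>x. x * K x)"
proof (rule Bochner_Integration.integrable_bound)
  show "integrable lborel (\<lambda>x. \<bar>x\<bar> powr 1 * K x)"
    by (rule band_kernel_integrable_powr) (use assms in auto)
  have "K \<in> borel_measurable borel" by (rule band_kernelD[OF assms(1)])
  then show "(\<lambda>x. x * K x) \<in> borel_measurable lborel" by simp
qed (auto simp: abs_mult)

text \<open>
  A band-limited kernel satisfies every polynomial decay bound, for all \<open>t\<close> and with an explicit
  constant: beyond the bandwidth there is nothing to show, and below it mass and first moment bound
  the transform and its derivative.
\<close>

lemma band_kernel_decay:
  assumes K: "band_kernel p R K" "1 \<le> p" and "0 < R" "0 < \<alpha>"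
  shows "\<bar>t\<bar> powr \<alpha> * cmod (fourier K t) \<le> R powr \<alpha> * (LINT u|lborel. K u)"
    and "\<bar>t\<bar> powr (\<alpha> + 1) * cmod (vector_derivative (fourier K) (at t)) \<le> R powr (\<alpha> + 1) * (LINT u|lborel. \<bar>u\<bar> * K u)"
proof -
  note b = band_kernelD[OF K(1)]
  have m: "(LINT u|lborel. \<bar>K u\<bar>) = (LINT u|lborel. K u)" "(LINT u|lborel. \<bar>u * K u\<bar>) = (LINT u|lborel. \<bar>u\<bar> * K u)"
    using b(1) by (simp_all add: abs_mult)
  show "\<bar>t\<bar> powr \<alpha> * cmod (fourier K t) \<le> R powr \<alpha> * (LINT u|lborel. K u)"
  proof (cases "R \<le> \<bar>t\<bar>")
    case False
    then show ?thesis
      using norm_fourier_le[of K t] assms unfolding m(1)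
      by (intro mult_mono powr_mono2) auto
  qed (use b in simp)
  show "\<bar>t\<bar> powr (\<alpha> + 1) * cmod (vector_derivative (fourier K) (at t)) \<le> R powr (\<alpha> + 1) * (LINT u|lborel. \<bar>u\<bar> * K u)"
  proof (cases "R < \<bar>t\<bar>")
    case False
    then show ?thesis
      using norm_vector_derivative_fourier_le[OF b(2) band_kernel_integrable_first_moment[OF K], of t] assms
      unfolding m(2) by (intro mult_mono powr_mono2) auto
  next
    case True
    \<comment> \<open>At \<open>\<bar>t\<bar> = R\<close> the first case applies, so here the transform vanishes in a neighbourhood of \<open>t\<close>.\<close>
    have "open ({..<-R} \<union> {R<..})" by auto
    moreover have "t \<in> {..<-R} \<union> {R<..}" using True by auto
    ultimately have "(fourier K has_vector_derivative 0) (at t)"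
      by (rule has_vector_derivative_transform_within_open[OF has_vector_derivative_const[of 0]]) (use b in auto)
    then show ?thesis using b(1) by (simp add: vector_derivative_at)
  qed
qed

definition rescale :: "real \<Rightarrow> (real \<Rightarrow> real) \<Rightarrow> real \<Rightarrow> real" where
  "rescale \<tau> K u = \<tau> * K (\<tau> * u)"

lemma fourier_rescale:
  assumes "0 < \<tau>"
  shows "fourier (rescale \<tau> K) t = fourier K (t / \<tau>)"
  using assms unfolding fourier_def rescale_def
  by (subst lborel_integral_real_affine[of \<tau> _ 0]) (simp_all add: scaleR_conv_of_real mult_ac flip: integral_mult_right_zero)

lemma integral_powr_rescale:
  assumes "0 < \<tau>"
  shows "(LINT u|lborel. \<bar>u\<bar> powr q * rescale \<tau> K u) = \<tau> powr (- q) * (LINT u|lborel. \<bar>u\<bar> powr q * K u)"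
  using assms unfolding rescale_def
  by (subst (2) lborel_integral_real_affine[of \<tau> _ 0])
     (simp_all add: abs_mult powr_mult powr_minus field_simps flip: integral_mult_right_zero)

lemma integral_rescale:
  assumes "0 < \<tau>"
  shows "(LINT u|lborel. rescale \<tau> K u) = (LINT u|lborel. K u)"
    and "(LINT u|lborel. \<bar>u\<bar> * rescale \<tau> K u) = (LINT u|lborel. \<bar>u\<bar> * K u) / \<tau>"
proof -
  show "(LINT u|lborel. rescale \<tau> K u) = (LINT u|lborel. K u)"
    using assms unfolding rescale_def by (subst (2) lborel_integral_real_affine[of \<tau> _ 0]) simp_all
  show "(LINT u|lborel. \<bar>u\<bar> * rescale \<tau> K u) = (LINT u|lborel. \<bar>u\<bar> * K u) / \<tau>"
    using assms integral_powr_rescale[OF assms, of 1 K] by (simp add: powr_minus divide_inverse mult.commute)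
qed

lemma band_kernel_rescale:
  assumes K: "band_kernel p R K" and "0 < \<tau>"
  shows "band_kernel p (\<tau> * R) (rescale \<tau> K)"
  unfolding band_kernel_def
proof (intro conjI allI impI)
  note b = band_kernelD[OF K]
  show "0 \<le> rescale \<tau> K x" for x using b assms by (simp add: rescale_def)
  show "integrable lborel (rescale \<tau> K)"
    using b(2) assms lborel_integrable_real_affine[of K \<tau> 0] by (simp add: rescale_def[abs_def])
  have "integrable lborel (\<lambda>x. \<bar>\<tau> * x\<bar> ^ p * K (\<tau> * x))"
    using K assms lborel_integrable_real_affine[of "\<lambda>x. \<bar>x\<bar> ^ p * K x" \<tau> 0] by (simp add: band_kernel_def)
  from integrable_mult_right[OF this, of "\<tau> / \<tau> ^ p"]
  show "integrable lborel (\<lambda>x. \<bar>x\<bar> ^ p * rescale \<tau> K x)"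
    using assms by (simp add: rescale_def abs_mult power_mult_distrib mult_ac)
  show "fourier (rescale \<tau> K) t = 0" if "\<tau> * R \<le> \<bar>t\<bar>" for t
    using that assms unfolding fourier_rescale[OF assms(2)]
    by (intro b) (simp add: abs_divide field_simps)
qed

section \<open>Gaussian smoothing\<close>

abbreviation (input) \<phi> :: "real \<Rightarrow> real" where "\<phi> \<equiv> std_normal_density"

text \<open>
  The function \<open>k\<close> may be signed or have any mass, so that differences of mixing densities are
  covered as well.
\<close>

definition gauss_conv :: "(real \<Rightarrow> real) \<Rightarrow> real \<Rightarrow> real" where
  "gauss_conv k x = (LINT u|lborel. \<phi> (x - u) * k u)"

lemma std_normal_density_le: "\<phi> x \<le> 1" 
proof -
  have "\<phi> x \<le> 1 / sqrt (2 * pi)"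
    by (simp add: std_normal_density_def divide_right_mono)
  also have "\<dots> \<le> 1" using pi_ge_two by (simp add: real_le_rsqrt)
  finally show ?thesis .
qed

lemma integrable_std_normal_density: "integrable lborel \<phi>"
  by (simp add: integrable_normal_density)

lemma gauss_conv_integrable:
  assumes "integrable lborel k"
  shows "integrable lborel (\<lambda>u. \<phi> (x - u) * k u)"
proof (rule Bochner_Integration.integrable_bound[OF assms])
  show "(\<lambda>u. \<phi> (x - u) * k u) \<in> borel_measurable lborel"
    using assms by (auto dest: borel_measurable_integrable)
  show "AE u in lborel. norm (\<phi> (x - u) * k u) \<le> norm (k u)"
    using std_normal_density_le by (auto simp: abs_mult mult_left_le_one_le)
qed

lemma gauss_conv_nonneg: "(\<And>u. 0 \<le> k u) \<Longrightarrow> 0 \<le> gauss_conv k x"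
  unfolding gauss_conv_def by (intro Bochner_Integration.integral_nonneg) auto

lemma gauss_conv_measurable [measurable]:
  assumes [measurable]: "k \<in> borel_measurable borel"
  shows "gauss_conv k \<in> borel_measurable borel"
  unfolding gauss_conv_def by measurable

lemma gauss_conv_linear:
  assumes "integrable lborel k" "integrable lborel l"
  shows "gauss_conv (\<lambda>u. a * k u + b * l u) x = a * gauss_conv k x + b * gauss_conv l x"
proof -
  have "gauss_conv (\<lambda>u. a * k u + b * l u) x = (LINT u|lborel. a * (\<phi> (x - u) * k u) + b * (\<phi> (x - u) * l u))"
    unfolding gauss_conv_def by (simp add: algebra_simps)
  then show ?thesis
    using assms by (simp add: gauss_conv_integrable gauss_conv_def)
qed

lemma nn_integral_gauss_conv:
  assumes [measurable]: "k \<in> borel_measurable borel" and "\<And>u. 0 \<le> k u" "integrable lborel k" 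
    and [measurable]: "w \<in> borel_measurable borel" and "\<And>x. 0 \<le> w x"
  shows "(\<integral>\<^sup>+x. ennreal (w x * gauss_conv k x) \<partial>lborel)
       = (\<integral>\<^sup>+u. (\<integral>\<^sup>+z. ennreal (w (u + z) * \<phi> z * k u) \<partial>lborel) \<partial>lborel)"
proof -
  have "(\<integral>\<^sup>+x. ennreal (w x * gauss_conv k x) \<partial>lborel) = (\<integral>\<^sup>+x. (\<integral>\<^sup>+u. ennreal (w x * (\<phi> (x - u) * k u)) \<partial>lborel) \<partial>lborel)"
    unfolding gauss_conv_def integral_mult_right_zero[symmetric] using assms
    by (intro nn_integral_cong nn_integral_eq_integral[symmetric] integrable_mult_right gauss_conv_integrable) auto
  also have "\<dots> = (\<integral>\<^sup>+u. (\<integral>\<^sup>+x. ennreal (w x * (\<phi> (x - u) * k u)) \<partial>lborel) \<partial>lborel)"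
    by (rule lborel_pair.Fubini') measurable
  also have "\<dots> = (\<integral>\<^sup>+u. (\<integral>\<^sup>+z. ennreal (w (u + z) * \<phi> z * k u) \<partial>lborel) \<partial>lborel)"
  proof (rule nn_integral_cong)
    fix u :: real
    show "(\<integral>\<^sup>+x. ennreal (w x * (\<phi> (x - u) * k u)) \<partial>lborel) = (\<integral>\<^sup>+z. ennreal (w (u + z) * \<phi> z * k u) \<partial>lborel)"
      by (subst nn_integral_real_affine[of _ 1 u]) (simp_all add: mult.assoc)
  qed
  finally show ?thesis .
qed

lemma abs_add_powr_le:
  fixes a b q :: real
  assumes "0 \<le> q"
  shows "\<bar>a + b\<bar> powr q \<le> 2 powr q * (\<bar>a\<bar> powr q + \<bar>b\<bar> powr q)"
proof -
  have "\<bar>a + b\<bar> powr q \<le> (2 * max \<bar>a\<bar> \<bar>b\<bar>) powr q" using assms by (intro powr_mono2) auto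
  also have "\<dots> = 2 powr q * max \<bar>a\<bar> \<bar>b\<bar> powr q" by (simp add: powr_mult)
  also have "max \<bar>a\<bar> \<bar>b\<bar> powr q \<le> \<bar>a\<bar> powr q + \<bar>b\<bar> powr q" by (simp add: max_def)
  finally show ?thesis by simp
qed

lemma abs_moment_nonneg: "0 \<le> abs_moment q"
  unfolding abs_moment_def by (intro Bochner_Integration.integral_nonneg) auto

lemma integrable_std_normal_powr:
  assumes "0 \<le> q"
  shows "integrable lborel (\<lambda>x. \<phi> x * \<bar>x\<bar> powr q)"
proof -
  obtain p :: nat where p: "q \<le> real p" using real_arch_simple by blast
  show ?thesis
  proof (rule Bochner_Integration.integrable_bound)
    show "integrable lborel (\<lambda>x. \<phi> x + \<phi> x * \<bar>x\<bar> ^ p)"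
      by (intro Bochner_Integration.integrable_add integrable_std_normal_density integrable_std_normal_moment_abs)
    show "AE x in lborel. norm (\<phi> x * \<bar>x\<bar> powr q) \<le> norm (\<phi> x + \<phi> x * \<bar>x\<bar> ^ p)"
    proof (rule AE_I2)
      fix x
      show "norm (\<phi> x * \<bar>x\<bar> powr q) \<le> norm (\<phi> x + \<phi> x * \<bar>x\<bar> ^ p)"
        using mult_left_mono[OF abs_powr_le_1_plus_power[OF assms p, of x], of "\<phi> x"]
        by (simp add: abs_mult algebra_simps)
    qed
  qed simp
qed

lemma nn_integral_powr_gauss_conv_le:
  assumes k: "k \<in> borel_measurable borel" "\<And>u. 0 \<le> k u" "integrable lborel k"
    and kq: "integrable lborel (\<lambda>u. \<bar>u\<bar> powr q * k u)" and q: "0 \<le> q"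
  shows "(\<integral>\<^sup>+x. ennreal (\<bar>x\<bar> powr q * gauss_conv k x) \<partial>lborel)
       \<le> ennreal (2 powr q * (abs_moment q * (LINT u|lborel. k u) + (LINT u|lborel. \<bar>u\<bar> powr q * k u)))"
proof -
  have [measurable]: "k \<in> borel_measurable borel" by fact
  note iq = integrable_std_normal_powr[OF q]
  have M: "0 \<le> abs_moment q" by (rule abs_moment_nonneg)
  have "(\<integral>\<^sup>+x. ennreal (\<bar>x\<bar> powr q * gauss_conv k x) \<partial>lborel)
     = (\<integral>\<^sup>+u. (\<integral>\<^sup>+z. ennreal (\<bar>u + z\<bar> powr q * \<phi> z * k u) \<partial>lborel) \<partial>lborel)"
    using k by (intro nn_integral_gauss_conv) auto
  also have "\<dots> \<le> (\<integral>\<^sup>+u. ennreal (2 powr q * (abs_moment q * k u + \<bar>u\<bar> powr q * k u)) \<partial>lborel)"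
  proof (rule nn_integral_mono)
    fix u :: real
    have "(\<integral>\<^sup>+z. ennreal (\<bar>u + z\<bar> powr q * \<phi> z * k u) \<partial>lborel)
      \<le> (\<integral>\<^sup>+z. ennreal (2 powr q * k u * (\<phi> z * \<bar>z\<bar> powr q) + 2 powr q * k u * \<bar>u\<bar> powr q * \<phi> z) \<partial>lborel)"
    proof (intro nn_integral_mono ennreal_leI)
      fix z :: real
      from mult_right_mono[OF abs_add_powr_le[OF q, of u z], of "\<phi> z * k u"] k(2)[of u]
      show "\<bar>u + z\<bar> powr q * \<phi> z * k u \<le> 2 powr q * k u * (\<phi> z * \<bar>z\<bar> powr q) + 2 powr q * k u * \<bar>u\<bar> powr q * \<phi> z"
        by (simp add: algebra_simps)
    qed
    also have "\<dots> = ennreal (LINT z|lborel. 2 powr q * k u * (\<phi> z * \<bar>z\<bar> powr q) + 2 powr q * k u * \<bar>u\<bar> powr q * \<phi> z)"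
      using k(2) iq integrable_std_normal_density
      by (intro nn_integral_eq_integral Bochner_Integration.integrable_add integrable_mult_right) (auto intro!: AE_I2 add_nonneg_nonneg)
    also have "(LINT z|lborel. 2 powr q * k u * (\<phi> z * \<bar>z\<bar> powr q) + 2 powr q * k u * \<bar>u\<bar> powr q * \<phi> z)
        = 2 powr q * k u * abs_moment q + 2 powr q * k u * \<bar>u\<bar> powr q"
      using iq integrable_std_normal_density integral_normal_density[of 1 0]
      by (subst Bochner_Integration.integral_add) (auto simp: abs_moment_def)
    finally show "(\<integral>\<^sup>+z. ennreal (\<bar>u + z\<bar> powr q * \<phi> z * k u) \<partial>lborel)
       \<le> ennreal (2 powr q * (abs_moment q * k u + \<bar>u\<bar> powr q * k u))"
      by (simp add: algebra_simps)
  qed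
  also have "\<dots> = ennreal (LINT u|lborel. 2 powr q * (abs_moment q * k u + \<bar>u\<bar> powr q * k u))"
    using k kq M by (intro nn_integral_eq_integral integrable_mult_right Bochner_Integration.integrable_add) (auto intro!: AE_I2)
  also have "(LINT u|lborel. 2 powr q * (abs_moment q * k u + \<bar>u\<bar> powr q * k u))
     = 2 powr q * (abs_moment q * (LINT u|lborel. k u) + (LINT u|lborel. \<bar>u\<bar> powr q * k u))"
    using k kq by simp
  finally show ?thesis .
qed

lemma std_normal_density_eq_fourier: "complex_of_real (\<phi> x) = 1 / sqrt (2 * pi) * (LINT t|lborel. iexp (x * t) * complex_of_real (\<phi> t))"
proof -
  have "complex_of_real (exp (- (x\<^sup>2) / 2)) = char std_normal_distribution x"
    by (simp add: char_std_normal_distribution)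
  also have "\<dots> = (LINT t|lborel. \<phi> t *\<^sub>R iexp (x * t))"
    unfolding char_def by (subst integral_density) auto
  finally show ?thesis
    by (simp add: std_normal_density_def scaleR_conv_of_real mult.commute)
qed

text \<open>
  The Gaussian density is, up to a factor, its own Fourier transform. Inserting this into the
  convolution and exchanging the integrals expresses the convolution by the transform of \<open>k\<close>.
\<close>

lemma gauss_conv_eq_fourier:
  assumes k: "integrable lborel k"
  shows "complex_of_real (gauss_conv k x)
    = 1 / sqrt (2 * pi) * (LINT t|lborel. iexp (x * t) * complex_of_real (\<phi> t) * fourier k (- t))"
proof -
  have [measurable]: "k \<in> borel_measurable borel" using k by (auto dest: borel_measurable_integrable)
  let ?g = "\<lambda>u t. (iexp ((x - u) * t) * complex_of_real (\<phi> t)) * complex_of_real (k u)"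
  have "complex_of_real (gauss_conv k x) = (LINT u|lborel. complex_of_real (\<phi> (x - u)) * complex_of_real (k u))"
    unfolding gauss_conv_def integral_complex_of_real[symmetric] by simp
  also have "\<dots> = (LINT u|lborel. 1 / sqrt (2 * pi) * (LINT t|lborel. ?g u t))"
    by (simp add: std_normal_density_eq_fourier[of "x - _"])
  also have "\<dots> = 1 / sqrt (2 * pi) * (LINT u|lborel. (LINT t|lborel. ?g u t))"
    by (rule integral_mult_right_zero)
  also have "(LINT u|lborel. (LINT t|lborel. ?g u t)) = (LINT t|lborel. (LINT u|lborel. ?g u t))"
  proof (rule lborel_pair.Fubini_integral[symmetric])
    have "integrable (lborel \<Otimes>\<^sub>M lborel) (\<lambda>(u, t). \<phi> t * k u)"
    proof (rule lborel_pair.Fubini_integrable)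
      show "integrable lborel (\<lambda>u. LINT t|lborel. norm (case (u, t) of (u, t) \<Rightarrow> \<phi> t * k u))"
        using k by (simp add: abs_mult)
      show "AE u in lborel. integrable lborel (\<lambda>t. case (u, t) of (u, t) \<Rightarrow> \<phi> t * k u)"
        using integrable_std_normal_density by simp
    qed measurable
    then show "integrable (lborel \<Otimes>\<^sub>M lborel) (\<lambda>(u, t). ?g u t)"
      by (rule Bochner_Integration.integrable_bound) (auto simp: norm_mult)
  qed
  also have "\<dots> = (LINT t|lborel. iexp (x * t) * complex_of_real (\<phi> t) * fourier k (- t))"
  proof (rule Bochner_Integration.integral_cong[OF refl])
    fix t
    have "(LINT u|lborel. ?g u t) = (LINT u|lborel. (iexp (x * t) * complex_of_real (\<phi> t)) * (iexp (- t * u) * complex_of_real (k u)))"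
      by (rule Bochner_Integration.integral_cong[OF refl]) (simp add: algebra_simps flip: exp_add)
    then show "(LINT u|lborel. ?g u t) = iexp (x * t) * complex_of_real (\<phi> t) * fourier k (- t)"
      unfolding fourier_def by (simp only: integral_mult_right_zero)
  qed
  finally show ?thesis .
qed

text \<open>
  A function \<open>k\<close> with transform \<open>1\<close> up to frequency \<open>\<tau>\<close> acts on the Gaussian density
  almost like a point mass at \<open>0\<close>, because only the frequencies above \<open>\<tau>\<close> contribute to the
  difference and the Gaussian density is small there. Half of the Gaussian exponent is used
  for smallness and the other half for integrability.
\<close>

lemma gauss_conv_approx:
  assumes k: "integrable lborel k" and \<tau>: "0 \<le> \<tau>"
    and one: "\<And>t. \<bar>t\<bar> \<le> \<tau> \<Longrightarrow> fourier k t = 1"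
    and B: "\<And>t. cmod (fourier k t) \<le> B"
  shows "\<bar>gauss_conv k x - \<phi> x\<bar> \<le> (1 + B) * exp (- \<tau>\<^sup>2 / 4)"
proof -
  have [measurable]: "k \<in> borel_measurable borel" using k by (auto dest: borel_measurable_integrable)
  have B0: "0 \<le> B" using B[of 0] norm_ge_zero order_trans by blast
  define G where "G t = iexp (x * t) * complex_of_real (\<phi> t) * (fourier k (- t) - 1)" for t
  have i1: "integrable lborel (\<lambda>t. iexp (x * t) * complex_of_real (\<phi> t))"
    by (rule integrable_iexp_times[OF integrable_std_normal_density])
  have i2: "integrable lborel (\<lambda>t. iexp (x * t) * complex_of_real (\<phi> t) * fourier k (- t))"
  proof (rule Bochner_Integration.integrable_bound)
    show "integrable lborel (\<lambda>t. B * \<phi> t)" using integrable_std_normal_density by simp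
    show "AE t in lborel. norm (iexp (x * t) * complex_of_real (\<phi> t) * fourier k (- t)) \<le> norm (B * \<phi> t)"
      using B B0 by (auto intro!: AE_I2 mult_left_mono simp: norm_mult mult.commute[of B])
  qed measurable
  have "complex_of_real (gauss_conv k x - \<phi> x) = 1 / sqrt (2 * pi) * (LINT t|lborel. G t)"
    using i1 i2 std_normal_density_eq_fourier[of x]
    by (simp add: gauss_conv_eq_fourier[OF k] G_def right_diff_distrib del: of_real_mult)
  then have "\<bar>gauss_conv k x - \<phi> x\<bar> = cmod (1 / sqrt (2 * pi) * (LINT t|lborel. G t))"
    by (metis norm_of_real)
  also have "\<dots> = 1 / sqrt (2 * pi) * cmod (LINT t|lborel. G t)"
    by (simp add: norm_mult norm_divide)
  also have "cmod (LINT t|lborel. G t) \<le> (LINT t|lborel. cmod (G t))"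
    by (rule integral_norm_bound)
  also have "\<dots> \<le> (LINT t|lborel. (1 + B) * exp (- \<tau>\<^sup>2 / 4) * sqrt 2 * normal_density 0 (sqrt 2) t)"
  proof (rule integral_mono_AE)
    show "integrable lborel (\<lambda>t. cmod (G t))"
      unfolding G_def right_diff_distrib using i1 i2 by (intro integrable_norm) simp
    show "integrable lborel (\<lambda>t. (1 + B) * exp (- \<tau>\<^sup>2 / 4) * sqrt 2 * normal_density 0 (sqrt 2) t)"
      by (intro integrable_mult_right integrable_normal_density) simp
    show "AE t in lborel. cmod (G t) \<le> (1 + B) * exp (- \<tau>\<^sup>2 / 4) * sqrt 2 * normal_density 0 (sqrt 2) t"
    proof (rule AE_I2)
      fix t :: real
      show "cmod (G t) \<le> (1 + B) * exp (- \<tau>\<^sup>2 / 4) * sqrt 2 * normal_density 0 (sqrt 2) t"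
      proof (cases "\<bar>t\<bar> \<le> \<tau>")
        case True
        then show ?thesis using B0 one[of "- t"] by (simp add: G_def)
      next
        case False
        then have sq: "\<tau>\<^sup>2 \<le> t\<^sup>2" using \<tau> by (simp add: abs_le_square_iff[symmetric])
        have "cmod (fourier k (- t) - 1) \<le> B + 1"
          by (rule order_trans[OF norm_triangle_ineq4]) (simp add: B)
        then have "cmod (G t) \<le> (1 + B) * \<phi> t"
          by (simp add: G_def norm_mult mult_right_mono mult.commute[of "\<phi> t"] add.commute[of B])
        also have "\<phi> t \<le> exp (- \<tau>\<^sup>2 / 4) * sqrt 2 * normal_density 0 (sqrt 2) t"
        proof -
          have "exp (- t\<^sup>2 / 2) \<le> exp (- \<tau>\<^sup>2 / 4) * exp (- t\<^sup>2 / 4)"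
            using sq by (simp flip: exp_add)
          then have "\<phi> t \<le> 1 / sqrt (2 * pi) * (exp (- \<tau>\<^sup>2 / 4) * exp (- t\<^sup>2 / 4))"
            unfolding std_normal_density_def by (intro mult_left_mono) auto
          also have "\<dots> = exp (- \<tau>\<^sup>2 / 4) * sqrt 2 * normal_density 0 (sqrt 2) t"
            by (simp add: normal_density_def real_sqrt_mult field_simps)
          finally show ?thesis .
        qed
        finally show ?thesis using B0 by (simp add: mult_left_mono mult.assoc)
      qed
    qed
  qed
  also have "\<dots> = (1 + B) * exp (- \<tau>\<^sup>2 / 4) * sqrt 2"
    using integral_normal_density[of "sqrt 2" 0] by simp
  finally have "\<bar>gauss_conv k x - \<phi> x\<bar> \<le> 1 / sqrt (2 * pi) * ((1 + B) * exp (- \<tau>\<^sup>2 / 4) * sqrt 2)"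
    by (simp add: divide_right_mono)
  also have "\<dots> = (1 + B) * exp (- \<tau>\<^sup>2 / 4) / sqrt pi"
    by (simp add: real_sqrt_mult)
  also have "\<dots> \<le> (1 + B) * exp (- \<tau>\<^sup>2 / 4) / 1"
    using B0 pi_ge_two by (intro divide_left_mono) (auto intro!: mult_nonneg_nonneg simp: real_le_rsqrt)
  finally show ?thesis by simp
qed

section \<open>Members of the parameter space with unit scale\<close>

text \<open>
  The mixing distribution is the law of \<open>(u, 1)\<close> with \<open>u\<close> distributed according to \<open>h\<close>.
  The decay bounds are assumed for all \<open>t\<close>, which is why \<open>T\<close> is arbitrary.
\<close>

lemma unit_scale_member:
  fixes h :: "real \<Rightarrow> real"
  assumes h [measurable]: "h \<in> borel_measurable borel" and nn: "\<And>u. 0 \<le> h u"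
    and int: "integrable lborel h" and one: "(LINT u|lborel. h u) = 1"
    and \<epsilon>: "0 < \<epsilon>" "\<epsilon> < 1" "\<epsilon> \<le> \<epsilon>0 * real n powr (- \<beta>)"
    and mom: "(\<integral>\<^sup>+x. ennreal (\<bar>x\<bar> powr q * ((1 - \<epsilon>) * \<phi> x + \<epsilon> * gauss_conv h x)) \<partial>lborel) \<le> ennreal (A powr q)"
    and diff: "\<And>t. fourier h differentiable (at t)"
    and decay: "\<And>t. \<bar>t\<bar> powr \<alpha> * cmod (fourier h t) \<le> A"
      "\<And>t. \<bar>t\<bar> powr (\<alpha> + 1) * cmod (vector_derivative (fourier h) (at t)) \<le> A"
  shows "(\<epsilon>, \<lambda>x. (1 - \<epsilon>) * \<phi> x + \<epsilon> * gauss_conv h x) \<in> Ftilde_unif T \<alpha> \<beta> \<epsilon>0 q A n"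
proof -
  define P where "P = density lborel (\<lambda>u. ennreal (h u))"
  define H where "H = distr P (borel \<Otimes>\<^sub>M borel) (\<lambda>u. (u, 1::real))"
  define h' where "h' = (\<lambda>u (\<sigma>::real). h u)"
  have nn1: "(\<integral>\<^sup>+u. ennreal (h u) \<partial>lborel) = 1"
    using nn_integral_eq_integral[OF int] nn one by simp
  have P: "prob_space P"
    unfolding P_def by (rule prob_spaceI) (simp add: emeasure_density nn1)
  have [measurable_cong]: "sets P = sets borel" by (simp add: P_def)
  have H: "prob_space H" unfolding H_def by (rule prob_space.prob_space_distr[OF P]) measurable
  have snd: "distr H borel snd = return borel 1"
    unfolding H_def by (subst distr_distr) (simp_all add: comp_def prob_space.distr_const[OF P])
  have dis: "H = density (lborel \<Otimes>\<^sub>M distr H borel snd) (\<lambda>p. ennreal (h' (fst p) (snd p)))"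
    unfolding snd
  proof (rule measure_eqI)
    show "sets H = sets (density (lborel \<Otimes>\<^sub>M return borel 1) (\<lambda>p. ennreal (h' (fst p) (snd p))))"
      unfolding H_def sets_distr sets_density by (intro sets_pair_measure_cong) simp_all
    fix X assume "X \<in> sets H"
    then have X [measurable]: "X \<in> sets (borel \<Otimes>\<^sub>M borel)" by (simp add: H_def)
    interpret R: prob_space "return borel (1::real)" by (rule prob_space_return) simp
    have "sets (borel \<Otimes>\<^sub>M borel) = sets (lborel \<Otimes>\<^sub>M return borel (1::real))"
      by (intro sets_pair_measure_cong) simp_all
    with X have X' [measurable]: "X \<in> sets (lborel \<Otimes>\<^sub>M return borel (1::real))" by simp
    have "emeasure H X = (\<integral>\<^sup>+p. indicator X p \<partial>H)" using \<open>X \<in> sets H\<close> by simp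
    also have "\<dots> = (\<integral>\<^sup>+u. ennreal (h u) * indicator X (u, 1) \<partial>lborel)"
      unfolding H_def by (subst nn_integral_distr) (simp_all add: P_def nn_integral_density)
    also have "\<dots> = (\<integral>\<^sup>+u. (\<integral>\<^sup>+\<sigma>. ennreal (h u) * indicator X (u, \<sigma>) \<partial>return borel 1) \<partial>lborel)"
      by (intro nn_integral_cong) (subst nn_integral_return; simp)
    also have "\<dots> = (\<integral>\<^sup>+p. ennreal (h (fst p)) * indicator X p \<partial>(lborel \<Otimes>\<^sub>M return borel 1))"
      using R.nn_integral_fst[of "\<lambda>p. ennreal (h (fst p)) * indicator X p" lborel] by simp
    also have "\<dots> = emeasure (density (lborel \<Otimes>\<^sub>M return borel 1) (\<lambda>p. ennreal (h' (fst p) (snd p)))) X"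
      unfolding h'_def by (subst emeasure_density) simp_all
    finally show "emeasure H X = emeasure (density (lborel \<Otimes>\<^sub>M return borel 1) (\<lambda>p. ennreal (h' (fst p) (snd p)))) X" .
  qed
  have mix: "mix_density \<epsilon> H = (\<lambda>x. (1 - \<epsilon>) * \<phi> x + \<epsilon> * gauss_conv h x)"
  proof
    fix x
    have "(LINT p|H. \<phi> ((x - fst p) / snd p) / snd p) = (LINT u|P. \<phi> (x - u))"
      unfolding H_def by (subst integral_distr) simp_all
    also have "\<dots> = gauss_conv h x"
      unfolding P_def gauss_conv_def by (subst integral_density) (simp_all add: nn mult.commute)
    finally show "mix_density \<epsilon> H x = (1 - \<epsilon>) * \<phi> x + \<epsilon> * gauss_conv h x"
      by (simp add: mix_density_def)
  qed
  have "AE p in H. 1 \<le> snd p"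
    unfolding H_def by (subst AE_distr_iff) simp_all
  moreover have "sets H = sets (borel \<Otimes>\<^sub>M borel)" by (simp add: H_def)
  ultimately have "eligible \<epsilon> H h'"
    unfolding eligible_def using \<epsilon> H dis nn nn1 by (simp add: h'_def)
  then have cls: "in_class \<beta> \<epsilon>0 q A n \<epsilon> H h'"
    unfolding in_class_def mix using \<epsilon> mom by simp
  have hh: "hhat h' \<sigma> = fourier h" for \<sigma>
    by (rule ext) (simp add: hhat_def fourier_def h'_def)
  have lm: "limsup_modulus T \<alpha> A h'" for T
    unfolding limsup_modulus_def hhat'_def hh by (intro allI impI conjI) (use decay in \<open>auto intro: add_increasing2\<close>)
  then have "smooth_cond \<alpha> A h'"
    unfolding smooth_cond_iff_modulus hh using diff by auto
  then show ?thesis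
    unfolding Ftilde_unif_def using cls lm mix by (auto intro!: exI[of _ \<epsilon>] exI[of _ H] exI[of _ h'])
qed

text \<open>For choosing constants: several bounds \<open>r * c\<^sub>i \<le> \<delta>\<close> are met at once by taking for \<open>c\<close> the sum of the \<open>c\<^sub>i\<close>.\<close>

lemma small_factor:
  fixes \<delta> c :: real
  assumes "0 < \<delta>" "0 \<le> c"
  obtains r where "0 < r" "r \<le> 1" "r * c \<le> \<delta>"
proof
  show "0 < \<delta> / (\<delta> + c)" "\<delta> / (\<delta> + c) \<le> 1" "\<delta> / (\<delta> + c) * c \<le> \<delta>"
    using assms by (auto simp: field_simps mult_nonneg_nonneg add_pos_nonneg)
qed

text \<open>
  The mixing measure \<open>e * g + d * k\<close> is normalised by its mass \<open>\<epsilon> \<ge> e\<close>. The common part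
  \<open>g\<close> may use half of the smoothness budget \<open>A\<close> and the spike \<open>k\<close>, whose transform enters with
  the factor \<open>d / e\<close> at most, the other half.
\<close>

lemma spiked_mixture_member:
  fixes g k :: "real \<Rightarrow> real"
  assumes g: "band_kernel p Rg g" "(LINT u|lborel. g u) = 1" and k: "band_kernel p Rk k"
    and p: "1 \<le> p" "0 \<le> q" "q \<le> real p" and R: "0 < Rg" "0 < Rk" and \<alpha>: "0 < \<alpha>"
    and e: "0 < e" and d: "0 \<le> d"
    and \<epsilon>_def: "\<epsilon> = e + d * (LINT u|lborel. k u)" and \<epsilon>: "\<epsilon> < 1" "\<epsilon> \<le> \<epsilon>0 * real n powr (- \<beta>)"
    and mom: "abs_moment q + 2 powr q * (abs_moment q * \<epsilon> + (e * (LINT u|lborel. \<bar>u\<bar> powr q * g u) + d * (LINT u|lborel. \<bar>u\<bar> powr q * k u))) \<le> A powr q"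
    and dg: "Rg powr \<alpha> \<le> A / 2" "Rg powr (\<alpha> + 1) * (LINT u|lborel. \<bar>u\<bar> * g u) \<le> A / 2"
    and dk: "d * (Rk powr \<alpha> * (LINT u|lborel. k u)) \<le> e * (A / 2)"
      "d * (Rk powr (\<alpha> + 1) * (LINT u|lborel. \<bar>u\<bar> * k u)) \<le> e * (A / 2)"
  shows "(\<epsilon>, \<lambda>x. (1 - \<epsilon>) * \<phi> x + (e * gauss_conv g x + d * gauss_conv k x)) \<in> Ftilde_unif T \<alpha> \<beta> \<epsilon>0 q A n"
proof -
  note gb = band_kernelD[OF g(1)] and kb = band_kernelD[OF k]
  have kint: "0 \<le> (LINT u|lborel. k u)" using kb(1) by (intro Bochner_Integration.integral_nonneg) auto
  have \<epsilon>e: "e \<le> \<epsilon>" using d kint by (simp add: \<epsilon>_def)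
  with e have \<epsilon>0: "0 < \<epsilon>" by simp
  define h where "h u = (e / \<epsilon>) * g u + (d / \<epsilon>) * k u" for u
  have [measurable]: "g \<in> borel_measurable borel" "k \<in> borel_measurable borel" using gb kb by auto
  have meas: "h \<in> borel_measurable borel" unfolding h_def by measurable
  have conv: "gauss_conv h x = (e / \<epsilon>) * gauss_conv g x + (d / \<epsilon>) * gauss_conv k x" for x
    unfolding h_def by (rule gauss_conv_linear[OF gb(2) kb(2)])
  have eqf: "(\<lambda>x. (1 - \<epsilon>) * \<phi> x + (e * gauss_conv g x + d * gauss_conv k x)) = (\<lambda>x. (1 - \<epsilon>) * \<phi> x + \<epsilon> * gauss_conv h x)"
    using \<epsilon>0 by (auto simp: conv field_simps)
  have four: "fourier h t = complex_of_real (e / \<epsilon>) * fourier g t + complex_of_real (d / \<epsilon>) * fourier k t" for t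
    unfolding h_def by (rule fourier_add[OF gb(2) kb(2)])
  have fourh: "fourier h = (\<lambda>t. complex_of_real (e / \<epsilon>) * fourier g t + complex_of_real (d / \<epsilon>) * fourier k t)"
    using four by auto
  have vg: "(fourier g has_vector_derivative vector_derivative (fourier g) (at t)) (at t)" for t
    using has_vector_derivative_fourier[OF gb(2) band_kernel_integrable_first_moment[OF g(1) p(1)], of t] vector_derivative_at by metis
  have vk: "(fourier k has_vector_derivative vector_derivative (fourier k) (at t)) (at t)" for t
    using has_vector_derivative_fourier[OF kb(2) band_kernel_integrable_first_moment[OF k p(1)], of t] vector_derivative_at by metis
  have vh: "(fourier h has_vector_derivative complex_of_real (e / \<epsilon>) * vector_derivative (fourier g) (at t) + complex_of_real (d / \<epsilon>) * vector_derivative (fourier k) (at t)) (at t)" for t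
    unfolding fourh by (intro has_vector_derivative_add has_vector_derivative_mult_right vg vk)
  have bound: "x * cmod (complex_of_real (e / \<epsilon>) * z + complex_of_real (d / \<epsilon>) * w) \<le> A"
    if "0 \<le> x" "x * cmod z \<le> A / 2" "d * (x * cmod w) \<le> e * (A / 2)" for x :: real and z w
  proof -
    have "x * cmod (complex_of_real (e / \<epsilon>) * z + complex_of_real (d / \<epsilon>) * w) \<le> x * (e / \<epsilon> * cmod z + d / \<epsilon> * cmod w)"
      using that(1) e d \<epsilon>0
      by (intro mult_left_mono order_trans[OF norm_triangle_ineq]) (auto simp: norm_mult simp del: of_real_divide)
    also have "\<dots> = (e * (x * cmod z) + d * (x * cmod w)) / \<epsilon>" by (simp add: field_simps add_divide_distrib)
    also have "\<dots> \<le> (e * (A / 2) + e * (A / 2)) / \<epsilon>"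
      using that e \<epsilon>0 by (intro divide_right_mono add_mono mult_left_mono) auto
    also have "\<dots> = (e / \<epsilon>) * A" by simp
    also have "\<dots> \<le> 1 * A"
    proof (rule mult_right_mono)
      show "e / \<epsilon> \<le> 1" using \<epsilon>e \<epsilon>0 by simp
      show "0 \<le> A" using dg(1) by (smt (verit) powr_ge_zero field_sum_of_halves)
    qed
    finally show ?thesis by simp
  qed
  show ?thesis
    unfolding eqf
  proof (rule unit_scale_member)
    show "h \<in> borel_measurable borel" by fact
    show "0 \<le> h u" for u unfolding h_def using gb(1) kb(1) e d \<epsilon>0 by simp
    show "integrable lborel h" unfolding h_def using gb(2) kb(2) by simp
    show "(LINT u|lborel. h u) = 1"
      unfolding h_def using gb(2) kb(2) g(2) \<epsilon>0 by (simp add: \<epsilon>_def flip: add_divide_distrib)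
    show "0 < \<epsilon>" "\<epsilon> < 1" "\<epsilon> \<le> \<epsilon>0 * real n powr (- \<beta>)" using \<epsilon>0 \<epsilon> by auto
    show "fourier h differentiable (at t)" for t
      using vh differentiableI_vector by blast
    show "\<bar>t\<bar> powr \<alpha> * cmod (fourier h t) \<le> A" for t
      unfolding four
    proof (rule bound)
      show "\<bar>t\<bar> powr \<alpha> * cmod (fourier g t) \<le> A / 2"
        using band_kernel_decay(1)[OF g(1) p(1) R(1) \<alpha>, of t] dg(1) g(2) by simp
      show "d * (\<bar>t\<bar> powr \<alpha> * cmod (fourier k t)) \<le> e * (A / 2)"
        using mult_left_mono[OF band_kernel_decay(1)[OF k p(1) R(2) \<alpha>, of t] d] dk(1) by simp
    qed simp
    show "\<bar>t\<bar> powr (\<alpha> + 1) * cmod (vector_derivative (fourier h) (at t)) \<le> A" for t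
      unfolding vector_derivative_at[OF vh]
    proof (rule bound)
      show "\<bar>t\<bar> powr (\<alpha> + 1) * cmod (vector_derivative (fourier g) (at t)) \<le> A / 2"
        using band_kernel_decay(2)[OF g(1) p(1) R(1) \<alpha>, of t] dg(2) by simp
      show "d * (\<bar>t\<bar> powr (\<alpha> + 1) * cmod (vector_derivative (fourier k) (at t))) \<le> e * (A / 2)"
        using mult_left_mono[OF band_kernel_decay(2)[OF k p(1) R(2) \<alpha>, of t] d] dk(2) by simp
    qed simp
    let ?l = "\<lambda>u. e * g u + d * k u"
    have convl: "gauss_conv ?l x = \<epsilon> * gauss_conv h x" for x
      unfolding gauss_conv_linear[OF gb(2) kb(2)] conv using \<epsilon>0 by (simp add: distrib_left)
    note gq = band_kernel_integrable_powr[OF g(1) p(2,3)] and kq = band_kernel_integrable_powr[OF k p(2,3)]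
    have lq: "(\<lambda>u. \<bar>u\<bar> powr q * ?l u) = (\<lambda>u. e * (\<bar>u\<bar> powr q * g u) + d * (\<bar>u\<bar> powr q * k u))"
      by (simp add: algebra_simps)
    have M: "0 \<le> abs_moment q" by (rule abs_moment_nonneg)
    have ln: "0 \<le> ?l u" for u using gb(1) kb(1) e d by simp
    have "(\<integral>\<^sup>+x. ennreal (\<bar>x\<bar> powr q * ((1 - \<epsilon>) * \<phi> x + \<epsilon> * gauss_conv h x)) \<partial>lborel)
      = (\<integral>\<^sup>+x. ennreal (1 - \<epsilon>) * ennreal (\<phi> x * \<bar>x\<bar> powr q) + ennreal (\<bar>x\<bar> powr q * gauss_conv ?l x) \<partial>lborel)"
    proof (rule nn_integral_cong)
      fix x
      have eq: "\<bar>x\<bar> powr q * ((1 - \<epsilon>) * \<phi> x + \<epsilon> * gauss_conv h x)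
          = (1 - \<epsilon>) * (\<phi> x * \<bar>x\<bar> powr q) + \<bar>x\<bar> powr q * gauss_conv ?l x"
        unfolding convl by (simp add: algebra_simps)
      have "0 \<le> gauss_conv ?l x" by (rule gauss_conv_nonneg[OF ln])
      then show "ennreal (\<bar>x\<bar> powr q * ((1 - \<epsilon>) * \<phi> x + \<epsilon> * gauss_conv h x))
         = ennreal (1 - \<epsilon>) * ennreal (\<phi> x * \<bar>x\<bar> powr q) + ennreal (\<bar>x\<bar> powr q * gauss_conv ?l x)"
        using \<epsilon>(1) by (subst eq) (simp add: ennreal_plus ennreal_mult)
    qed
    also have "\<dots> = ennreal (1 - \<epsilon>) * (\<integral>\<^sup>+x. ennreal (\<phi> x * \<bar>x\<bar> powr q) \<partial>lborel) + (\<integral>\<^sup>+x. ennreal (\<bar>x\<bar> powr q * gauss_conv ?l x) \<partial>lborel)"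
      by (subst nn_integral_add) (simp_all add: nn_integral_cmult)
    also have "(\<integral>\<^sup>+x. ennreal (\<phi> x * \<bar>x\<bar> powr q) \<partial>lborel) = ennreal (abs_moment q)"
      unfolding abs_moment_def by (rule nn_integral_eq_integral) (simp_all add: integrable_std_normal_powr p)
    also have "ennreal (1 - \<epsilon>) * ennreal (abs_moment q) \<le> ennreal (abs_moment q)"
      using \<epsilon>0 \<epsilon>(1) M by (simp add: mult_left_le_one_le flip: ennreal_mult)
    also have "(\<integral>\<^sup>+x. ennreal (\<bar>x\<bar> powr q * gauss_conv ?l x) \<partial>lborel)
        \<le> ennreal (2 powr q * (abs_moment q * (LINT u|lborel. ?l u) + (LINT u|lborel. \<bar>u\<bar> powr q * ?l u)))"
      by (rule nn_integral_powr_gauss_conv_le) (use ln gb kb lq gq kq p in simp_all)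
    also have "(LINT u|lborel. ?l u) = \<epsilon>"
      using gb(2) kb(2) g(2) by (simp add: \<epsilon>_def)
    also have "(LINT u|lborel. \<bar>u\<bar> powr q * ?l u) = e * (LINT u|lborel. \<bar>u\<bar> powr q * g u) + d * (LINT u|lborel. \<bar>u\<bar> powr q * k u)"
      unfolding lq using gq kq by simp
    also have "ennreal (abs_moment q) + ennreal (2 powr q * (abs_moment q * \<epsilon> + (e * (LINT u|lborel. \<bar>u\<bar> powr q * g u) + d * (LINT u|lborel. \<bar>u\<bar> powr q * k u))))
        \<le> ennreal (A powr q)"
    proof (subst ennreal_plus[symmetric])
      have "0 \<le> (LINT u|lborel. \<bar>u\<bar> powr q * g u)" "0 \<le> (LINT u|lborel. \<bar>u\<bar> powr q * k u)"
        using gb(1) kb(1) by (auto intro!: Bochner_Integration.integral_nonneg)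
      then show "0 \<le> 2 powr q * (abs_moment q * \<epsilon> + (e * (LINT u|lborel. \<bar>u\<bar> powr q * g u) + d * (LINT u|lborel. \<bar>u\<bar> powr q * k u)))"
        using M \<epsilon>0 e d by (intro mult_nonneg_nonneg add_nonneg_nonneg) auto
    qed (use M mom in \<open>auto intro: ennreal_leI\<close>)
    finally show "(\<integral>\<^sup>+x. ennreal (\<bar>x\<bar> powr q * ((1 - \<epsilon>) * \<phi> x + \<epsilon> * gauss_conv h x)) \<partial>lborel) \<le> ennreal (A powr q)"
      by (simp add: add_mono)
  qed
qed

section \<open>Two-point lower bounds\<close>

text \<open>
  Monotonicity of product measures in the density of the factors, without requiring that they are
  probability densities.
\<close>

lemma PiM_nn_integral_mono_measure:
  fixes f m :: "real \<Rightarrow> real"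
  assumes [measurable]: "f \<in> borel_measurable borel" "m \<in> borel_measurable borel"
    and le: "\<And>x. m x \<le> f x" and fin: "finite I"
    and F: "F \<in> borel_measurable (\<Pi>\<^sub>M i\<in>I. borel)"
  shows "(\<integral>\<^sup>+X. F X \<partial>(\<Pi>\<^sub>M i\<in>I. density lborel (\<lambda>x. ennreal (m x)))) \<le> (\<integral>\<^sup>+X. F X \<partial>(\<Pi>\<^sub>M i\<in>I. density lborel (\<lambda>x. ennreal (f x))))"
  using fin F
proof (induction I arbitrary: F)
  case empty
  show ?case by (simp add: PiM_empty)
next
  case (insert i I)
  have sf: "sigma_finite_measure (density lborel (\<lambda>x. ennreal (k x)))" if "k \<in> borel_measurable borel" for k :: "real \<Rightarrow> real"
    using that by (subst sigma_finite_measure.sigma_finite_iff_density_finite[OF sigma_finite_lborel]) auto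
  interpret M: product_sigma_finite "\<lambda>_::'a. density lborel (\<lambda>x. ennreal (m x))"
    by (intro product_sigma_finite.intro sf) measurable
  interpret N: product_sigma_finite "\<lambda>_::'a. density lborel (\<lambda>x. ennreal (f x))"
    by (intro product_sigma_finite.intro sf) measurable
  have sM: "sets (\<Pi>\<^sub>M i\<in>J. density lborel (\<lambda>x. ennreal (m x))) = sets (\<Pi>\<^sub>M i\<in>J. borel :: real measure)" for J :: "'a set"
    by (intro sets_PiM_cong) auto
  have sN: "sets (\<Pi>\<^sub>M i\<in>J. density lborel (\<lambda>x. ennreal (f x))) = sets (\<Pi>\<^sub>M i\<in>J. borel :: real measure)" for J :: "'a set"
    by (intro sets_PiM_cong) auto
  have [measurable]: "F \<in> borel_measurable (\<Pi>\<^sub>M i\<in>insert i I. borel)" by (rule insert.prems)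
  have FM: "F \<in> borel_measurable (\<Pi>\<^sub>M i\<in>insert i I. density lborel (\<lambda>x. ennreal (m x)))"
    and FN: "F \<in> borel_measurable (\<Pi>\<^sub>M i\<in>insert i I. density lborel (\<lambda>x. ennreal (f x)))"
    using insert.prems by (simp_all cong: measurable_cong_sets add: sM sN)
  have upd: "(\<lambda>(X, y). F (X(i := y))) \<in> borel_measurable ((\<Pi>\<^sub>M i\<in>I. borel) \<Otimes>\<^sub>M borel)"
    by measurable
  have [measurable]: "(\<lambda>X. \<integral>\<^sup>+y. F (X(i := y)) \<partial>density lborel (\<lambda>x. ennreal (f x))) \<in> borel_measurable (\<Pi>\<^sub>M i\<in>I. borel)"
    by measurable
  have "(\<integral>\<^sup>+X. F X \<partial>(\<Pi>\<^sub>M i\<in>insert i I. density lborel (\<lambda>x. ennreal (m x))))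
     = (\<integral>\<^sup>+X. (\<integral>\<^sup>+y. F (X(i := y)) \<partial>density lborel (\<lambda>x. ennreal (m x))) \<partial>(\<Pi>\<^sub>M i\<in>I. density lborel (\<lambda>x. ennreal (m x))))"
    by (rule M.product_nn_integral_insert[OF insert.hyps FM])
  also have "\<dots> \<le> (\<integral>\<^sup>+X. (\<integral>\<^sup>+y. F (X(i := y)) \<partial>density lborel (\<lambda>x. ennreal (f x))) \<partial>(\<Pi>\<^sub>M i\<in>I. density lborel (\<lambda>x. ennreal (m x))))"
  proof (rule nn_integral_mono)
    fix X assume "X \<in> space (\<Pi>\<^sub>M i\<in>I. density lborel (\<lambda>x. ennreal (m x)))"
    then have X: "X \<in> space (\<Pi>\<^sub>M i\<in>I. borel)" by (simp add: space_PiM)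
    have [measurable]: "(\<lambda>y. F (X(i := y))) \<in> borel_measurable borel"
      using measurable_compose[OF measurable_Pair1'[OF X] upd] by simp
    show "(\<integral>\<^sup>+y. F (X(i := y)) \<partial>density lborel (\<lambda>x. ennreal (m x))) \<le> (\<integral>\<^sup>+y. F (X(i := y)) \<partial>density lborel (\<lambda>x. ennreal (f x)))"
      by (simp add: nn_integral_density) (intro nn_integral_mono mult_right_mono ennreal_leI le; simp)
  qed
  also have "\<dots> \<le> (\<integral>\<^sup>+X. (\<integral>\<^sup>+y. F (X(i := y)) \<partial>density lborel (\<lambda>x. ennreal (f x))) \<partial>(\<Pi>\<^sub>M i\<in>I. density lborel (\<lambda>x. ennreal (f x))))"
    by (rule insert.IH) measurable
  also have "\<dots> = (\<integral>\<^sup>+X. F X \<partial>(\<Pi>\<^sub>M i\<in>insert i I. density lborel (\<lambda>x. ennreal (f x))))"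
    by (rule N.product_nn_integral_insert[OF insert.hyps FN, symmetric])
  finally show ?case .
qed

text \<open>
  Le Cam's method. Both product measures dominate the product \<open>Q\<close> of the measures with density
  \<open>min f0 f1\<close>, whose mass is at least \<open>1 / 2\<close> by Bernoulli's inequality. On \<open>Q\<close> an
  estimator has to serve two parameters at once, so its two quadratic losses add up to at least
  half of their squared distance.
\<close>

lemma two_point_lower_bound:
  fixes f0 f1 :: "real \<Rightarrow> real"
  assumes mem: "(a0, f0) \<in> \<F>" "(a1, f1) \<in> \<F>"
    and [measurable]: "f0 \<in> borel_measurable borel" "f1 \<in> borel_measurable borel"
    and nn: "\<And>x. 0 \<le> f0 x" "\<And>x. 0 \<le> f1 x"
    and int: "integrable lborel f0" "integrable lborel f1" and one: "(LINT x|lborel. f0 x) = 1"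
    and dist: "real n * (LINT x|lborel. \<bar>f1 x - f0 x\<bar>) \<le> 1 / 2" and n: "0 < n"
    and est: "est \<in> borel_measurable (\<Pi>\<^sub>M i\<in>{1..n}. borel)"
  shows "ennreal ((a1 - a0)\<^sup>2 / 8) \<le> max_risk \<F> n est"
proof -
  define m where "m x = min (f0 x) (f1 x)" for x
  define Q where "Q = (\<Pi>\<^sub>M i\<in>{1..n}. density lborel (\<lambda>x. ennreal (m x)))"
  define v where "v = (LINT x|lborel. m x)"
  have [measurable]: "m \<in> borel_measurable borel" unfolding m_def by measurable
  have mint: "integrable lborel m" unfolding m_def using int by simp
  have mn: "0 \<le> m x" for x using nn by (simp add: m_def)
  have v0: "0 \<le> v" unfolding v_def by (intro Bochner_Integration.integral_nonneg mn)
  have v: "1 - (LINT x|lborel. \<bar>f1 x - f0 x\<bar>) \<le> v"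
  proof -
    have "(LINT x|lborel. f0 x - \<bar>f1 x - f0 x\<bar>) \<le> v"
      unfolding v_def using int mint by (intro integral_mono) (auto simp: m_def)
    then show ?thesis using int one by simp
  qed
  have vn: "1 / 2 \<le> v ^ n"
  proof -
    let ?D = "LINT x|lborel. \<bar>f1 x - f0 x\<bar>"
    have D0: "0 \<le> ?D" by (intro Bochner_Integration.integral_nonneg) auto
    have "?D \<le> real n * ?D" using mult_right_mono[of 1 "real n" ?D] n D0 by simp
    then have D1: "?D \<le> 1" using dist by linarith
    have "1 + real n * (- ?D) \<le> (1 + (- ?D)) ^ n" by (rule Bernoulli_inequality) (use D1 in simp)
    also have "\<dots> \<le> v ^ n" using v D1 by (intro power_mono) auto
    finally show ?thesis using dist by simp
  qed
  have sf: "sigma_finite_measure (density lborel (\<lambda>x. ennreal (m x)))"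
    by (subst sigma_finite_measure.sigma_finite_iff_density_finite[OF sigma_finite_lborel]) auto
  interpret Q: product_sigma_finite "\<lambda>_::nat. density lborel (\<lambda>x. ennreal (m x))"
    by (intro product_sigma_finite.intro sf)
  have estQ [measurable]: "est \<in> borel_measurable Q"
    using est unfolding Q_def by (subst measurable_cong_sets[OF sets_PiM_cong[OF refl] refl]) auto
  have mass: "emeasure Q (space Q) = ennreal (v ^ n)"
  proof -
    have "emeasure Q (space Q) = (\<Prod>i\<in>{1..n}. emeasure (density lborel (\<lambda>x. ennreal (m x))) UNIV)"
      unfolding Q_def using Q.emeasure_PiM[of "{1..n}" "\<lambda>_. UNIV"] by (simp add: space_PiM)
    also have "emeasure (density lborel (\<lambda>x. ennreal (m x))) UNIV = ennreal v"
      unfolding v_def by (simp add: emeasure_density nn_integral_eq_integral[OF mint] mn)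
    finally show ?thesis using v0 by (simp add: ennreal_power)
  qed
  have low: "(\<integral>\<^sup>+X. ennreal ((est X - a)\<^sup>2) \<partial>Q) \<le> max_risk \<F> n est"
    if "(a, f) \<in> \<F>" "f \<in> borel_measurable borel" "\<And>x. m x \<le> f x" for a f
  proof -
    have "(\<integral>\<^sup>+X. ennreal ((est X - a)\<^sup>2) \<partial>Q) \<le> (\<integral>\<^sup>+X. ennreal ((est X - a)\<^sup>2) \<partial>sample f n)"
      unfolding Q_def sample_def using that est
      by (intro PiM_nn_integral_mono_measure) auto
    also have "\<dots> \<le> max_risk \<F> n est"
      unfolding max_risk_def by (rule SUP_upper2[OF that(1)]) simp
    finally show ?thesis .
  qed
  have "ennreal ((a1 - a0)\<^sup>2 / 2) * ennreal (1 / 2) \<le> ennreal ((a1 - a0)\<^sup>2 / 2) * emeasure Q (space Q)"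
    unfolding mass by (intro mult_left_mono ennreal_leI vn) simp
  also have "\<dots> = (\<integral>\<^sup>+X. ennreal ((a1 - a0)\<^sup>2 / 2) \<partial>Q)" by simp
  also have "\<dots> \<le> (\<integral>\<^sup>+X. ennreal ((est X - a0)\<^sup>2) + ennreal ((est X - a1)\<^sup>2) \<partial>Q)"
  proof (rule nn_integral_mono)
    fix X
    have "(a1 - a0)\<^sup>2 = 2 * ((est X - a0)\<^sup>2 + (est X - a1)\<^sup>2) - ((est X - a0) + (est X - a1))\<^sup>2"
      by (simp add: power2_eq_square algebra_simps)
    also have "\<dots> \<le> 2 * ((est X - a0)\<^sup>2 + (est X - a1)\<^sup>2)" by simp
    finally have "(a1 - a0)\<^sup>2 / 2 \<le> (est X - a0)\<^sup>2 + (est X - a1)\<^sup>2" by simp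
    then show "ennreal ((a1 - a0)\<^sup>2 / 2) \<le> ennreal ((est X - a0)\<^sup>2) + ennreal ((est X - a1)\<^sup>2)"
      by (simp add: ennreal_leI flip: ennreal_plus)
  qed
  also have "\<dots> = (\<integral>\<^sup>+X. ennreal ((est X - a0)\<^sup>2) \<partial>Q) + (\<integral>\<^sup>+X. ennreal ((est X - a1)\<^sup>2) \<partial>Q)"
    by (rule nn_integral_add) measurable
  also have "\<dots> \<le> max_risk \<F> n est + max_risk \<F> n est"
    by (intro add_mono low[OF mem(1)] low[OF mem(2)]) (simp_all add: m_def)
  also have "\<dots> = 2 * max_risk \<F> n est" by (simp add: mult_2)
  finally have "ennreal ((a1 - a0)\<^sup>2 / 2) * ennreal (1 / 2) \<le> 2 * max_risk \<F> n est" .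
  then have "ennreal (1 / 2) * (ennreal ((a1 - a0)\<^sup>2 / 2) * ennreal (1 / 2)) \<le> ennreal (1 / 2) * (2 * max_risk \<F> n est)"
    by (rule mult_left_mono) simp
  also have "\<dots> = (ennreal (1 / 2) * ennreal 2) * max_risk \<F> n est" by (simp add: mult.assoc)
  also have "ennreal (1 / 2) * ennreal 2 = 1" by (subst ennreal_mult[symmetric]) simp_all
  also have "ennreal (1 / 2) * (ennreal ((a1 - a0)\<^sup>2 / 2) * ennreal (1 / 2)) = ennreal ((a1 - a0)\<^sup>2 / 8)"
  proof -
    have "ennreal ((a1 - a0)\<^sup>2 / 8) = ennreal (1 / 2 * ((a1 - a0)\<^sup>2 / 2 * (1 / 2)))" by simp
    also have "\<dots> = ennreal (1 / 2) * ennreal ((a1 - a0)\<^sup>2 / 2 * (1 / 2))" by (rule ennreal_mult') simp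
    also have "ennreal ((a1 - a0)\<^sup>2 / 2 * (1 / 2)) = ennreal ((a1 - a0)\<^sup>2 / 2) * ennreal (1 / 2)" by (rule ennreal_mult') simp
    finally show ?thesis by (rule sym)
  qed
  finally show ?thesis by simp
qed

text \<open>
  A uniform bound is integrated over \<open>[-N, N]\<close>; outside, Markov's inequality for the \<open>q\<close>-th
  moments takes over.
\<close>

lemma integral_abs_diff_le:
  fixes f0 f1 :: "real \<Rightarrow> real"
  assumes [measurable]: "f0 \<in> borel_measurable borel" "f1 \<in> borel_measurable borel"
    and nn: "\<And>x. 0 \<le> f0 x" "\<And>x. 0 \<le> f1 x"
    and mom: "(\<integral>\<^sup>+x. ennreal (\<bar>x\<bar> powr q * f0 x) \<partial>lborel) \<le> ennreal B" "(\<integral>\<^sup>+x. ennreal (\<bar>x\<bar> powr q * f1 x) \<partial>lborel) \<le> ennreal B"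
    and B: "0 \<le> B" and q: "0 \<le> q" and N: "0 < N" and s: "0 \<le> s" "\<And>x. \<bar>f1 x - f0 x\<bar> \<le> s"
  shows "(LINT x|lborel. \<bar>f1 x - f0 x\<bar>) \<le> 2 * N * s + 2 * B * N powr (- q)"
proof -
  have "(\<integral>\<^sup>+x. ennreal \<bar>f1 x - f0 x\<bar> \<partial>lborel)
    \<le> (\<integral>\<^sup>+x. ennreal s * indicator {-N..N} x + ennreal (N powr (- q)) * (ennreal (\<bar>x\<bar> powr q * f0 x) + ennreal (\<bar>x\<bar> powr q * f1 x)) \<partial>lborel)"
  proof (rule nn_integral_mono)
    fix x :: real
    show "ennreal \<bar>f1 x - f0 x\<bar> \<le> ennreal s * indicator {-N..N} x + ennreal (N powr (- q)) * (ennreal (\<bar>x\<bar> powr q * f0 x) + ennreal (\<bar>x\<bar> powr q * f1 x))"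
    proof (cases "\<bar>x\<bar> \<le> N")
      case True
      then have "x \<in> {-N..N}" by auto
      then show ?thesis using s by (simp add: add_increasing2 ennreal_leI)
    next
      case False
      have "N powr q \<le> \<bar>x\<bar> powr q" using False N q by (intro powr_mono2) auto
      from mult_left_mono[OF this, of "N powr (- q)"] have "1 \<le> N powr (- q) * \<bar>x\<bar> powr q"
        using N by (simp add: powr_add[symmetric])
      from mult_right_mono[OF this, of "f0 x + f1 x"] nn[of x]
      have "f0 x + f1 x \<le> N powr (- q) * (\<bar>x\<bar> powr q * f0 x + \<bar>x\<bar> powr q * f1 x)"
        by (simp add: algebra_simps)
      moreover have "\<bar>f1 x - f0 x\<bar> \<le> f0 x + f1 x" using nn[of x] by simp
      ultimately have "\<bar>f1 x - f0 x\<bar> \<le> N powr (- q) * (\<bar>x\<bar> powr q * f0 x + \<bar>x\<bar> powr q * f1 x)" by linarith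
      then have "ennreal \<bar>f1 x - f0 x\<bar> \<le> ennreal (N powr (- q)) * (ennreal (\<bar>x\<bar> powr q * f0 x) + ennreal (\<bar>x\<bar> powr q * f1 x))"
        using nn[of x] by (simp add: ennreal_leI flip: ennreal_plus ennreal_mult)
      then show ?thesis by (simp add: add_increasing)
    qed
  qed
  also have "\<dots> = ennreal s * ennreal (2 * N) + ennreal (N powr (- q)) *
      ((\<integral>\<^sup>+x. ennreal (\<bar>x\<bar> powr q * f0 x) \<partial>lborel) + (\<integral>\<^sup>+x. ennreal (\<bar>x\<bar> powr q * f1 x) \<partial>lborel))"
    using N by (simp add: nn_integral_add nn_integral_cmult)
  also have "\<dots> \<le> ennreal s * ennreal (2 * N) + ennreal (N powr (- q)) * (ennreal B + ennreal B)"
    by (intro add_mono mult_left_mono mom) auto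
  also have "\<dots> = ennreal (2 * N * s + 2 * B * N powr (- q))"
    using B N s by (simp add: algebra_simps flip: ennreal_plus ennreal_mult)
  finally show ?thesis
    using B N s by (intro integral_real_bounded) auto
qed

section \<open>Characteristic functions of eligible mixtures\<close>

lemma char_normal_density:
  assumes "0 < \<sigma>"
  shows "(LINT x|lborel. iexp (t * x) * complex_of_real (\<phi> ((x - u) / \<sigma>) / \<sigma>)) = iexp (t * u) * exp (- (\<sigma> * t)\<^sup>2 / 2)"
proof -
  have "(LINT x|lborel. iexp (t * x) * complex_of_real (\<phi> ((x - u) / \<sigma>) / \<sigma>))
     = \<bar>\<sigma>\<bar> *\<^sub>R (LINT z|lborel. iexp (t * (u + \<sigma> * z)) * complex_of_real (\<phi> z / \<sigma>))"
    using assms by (subst lborel_integral_real_affine[of \<sigma> _ u]) auto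
  also have "\<dots> = (LINT z|lborel. iexp (t * u) * (\<phi> z *\<^sub>R iexp (\<sigma> * t * z)))"
    unfolding integral_scaleR_right[symmetric] using assms
    by (intro Bochner_Integration.integral_cong refl) (simp add: scaleR_conv_of_real algebra_simps exp_add)
  also have "\<dots> = iexp (t * u) * (LINT z|lborel. \<phi> z *\<^sub>R iexp (\<sigma> * t * z))"
    by (rule integral_mult_right_zero)
  also have "(LINT z|lborel. \<phi> z *\<^sub>R iexp (\<sigma> * t * z)) = char std_normal_distribution (\<sigma> * t)"
    unfolding char_def by (subst integral_density) auto
  also have "\<dots> = exp (- (\<sigma> * t)\<^sup>2 / 2)"
    by (simp add: char_std_normal_distribution)
  finally show ?thesis by simp
qed

lemma nn_integral_normal_component:
  assumes "0 < \<sigma>"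
  shows "(\<integral>\<^sup>+x. ennreal (\<phi> ((x - u) / \<sigma>) / \<sigma>) \<partial>lborel) = 1"
proof -
  have "\<phi> ((x - u) / \<sigma>) / \<sigma> = normal_density u \<sigma> x" for x
    using assms by (simp add: normal_density_def real_sqrt_mult power_divide field_simps)
  then show ?thesis
    using assms integral_normal_density[of \<sigma> u] integrable_normal_density[of \<sigma> u] nn_integral_eq_integral[of lborel "normal_density u \<sigma>"]
    by simp
qed

context
  fixes \<epsilon> :: real and H :: "(real \<times> real) measure" and h :: "real \<Rightarrow> real \<Rightarrow> real"
  assumes el: "eligible \<epsilon> H h"
begin

text \<open>
  All facts follow from Fubini's theorem for the product of the mixing distribution and Lebesgue
  measure. The kernel is a probability density in the second variable only for almost all parameters,
  those with \<open>\<sigma> \<ge> 1\<close>.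
\<close>

lemma mix_density_facts:
  shows mix_density_measurable: "mix_density \<epsilon> H \<in> borel_measurable borel"
    and mix_density_nonneg: "0 \<le> mix_density \<epsilon> H x"
    and integrable_mix_density: "integrable lborel (mix_density \<epsilon> H)"
    and char_mix_density: "(LINT x|lborel. iexp (t * x) * complex_of_real (mix_density \<epsilon> H x))
       = (1 - \<epsilon>) * exp (- t\<^sup>2 / 2) + \<epsilon> * (LINT p|H. iexp (t * fst p) * complex_of_real (exp (- (snd p * t)\<^sup>2 / 2)))"
proof -
  have \<epsilon>: "0 < \<epsilon>" "\<epsilon> < 1" and H: "prob_space H" and sH [measurable_cong]: "sets H = sets (borel \<Otimes>\<^sub>M borel)"
    and ae: "AE p in H. 1 \<le> snd p"
    using el by (auto simp: eligible_def)
  interpret H: prob_space H by fact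
  interpret P: pair_sigma_finite H lborel ..
  define g where "g p x = \<phi> ((x - fst p) / snd p) / snd p" for p :: "real \<times> real" and x
  have [measurable]: "(\<lambda>(p, x). g p x) \<in> borel_measurable (H \<Otimes>\<^sub>M lborel)"
    unfolding g_def by measurable
  have g1: "AE p in H. (\<integral>\<^sup>+x. ennreal (g p x) \<partial>lborel) = 1 \<and> (\<forall>x. 0 \<le> g p x)"
    using ae unfolding g_def by eventually_elim (simp add: nn_integral_normal_component)
  have gint: "AE p in H. integrable lborel (g p) \<and> (LINT x|lborel. norm (g p x)) = 1"
    using g1
  proof eventually_elim
    case (elim p)
    have [measurable]: "g p \<in> borel_measurable borel" unfolding g_def by measurable
    have "integrable lborel (g p)" using elim by (intro integrableI_nonneg) auto
    moreover have "(LINT x|lborel. norm (g p x)) = 1"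
      using elim by (subst integral_eq_nn_integral) auto
    ultimately show ?case by simp
  qed
  have G: "integrable (H \<Otimes>\<^sub>M lborel) (\<lambda>(p, x). g p x)"
  proof (rule P.Fubini_integrable)
    have "integrable H (\<lambda>p. LINT x|lborel. norm (case (p, x) of (p, x) \<Rightarrow> g p x)) \<longleftrightarrow> integrable H (\<lambda>p. 1 :: real)"
      using gint by (intro integrable_cong_AE) (auto, measurable)
    then show "integrable H (\<lambda>p. LINT x|lborel. norm (case (p, x) of (p, x) \<Rightarrow> g p x))" by simp
    show "AE p in H. integrable lborel (\<lambda>x. case (p, x) of (p, x) \<Rightarrow> g p x)" using gint by auto
  qed measurable
  have mix: "mix_density \<epsilon> H = (\<lambda>x. (1 - \<epsilon>) * \<phi> x + \<epsilon> * (LINT p|H. g p x))"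
    by (rule ext) (simp add: mix_density_def g_def)
  have Gx: "integrable lborel (\<lambda>x. LINT p|H. g p x)"
    using P.integrable_snd[OF G] by simp
  show "mix_density \<epsilon> H \<in> borel_measurable borel"
    using Gx unfolding mix by (auto dest: borel_measurable_integrable)
  show "integrable lborel (mix_density \<epsilon> H)"
    unfolding mix using Gx integrable_std_normal_density by simp
  show "0 \<le> mix_density \<epsilon> H x"
  proof -
    have "0 \<le> (LINT p|H. g p x)" using g1 by (intro integral_nonneg_AE) auto
    then show ?thesis using \<epsilon> by (simp add: mix)
  qed
  have G': "integrable (H \<Otimes>\<^sub>M lborel) (\<lambda>(p, x). iexp (t * x) * complex_of_real (g p x))"
    by (rule Bochner_Integration.integrable_bound[OF G]) (auto simp: norm_mult)
  have "(LINT x|lborel. iexp (t * x) * complex_of_real (LINT p|H. g p x))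
      = (LINT x|lborel. (LINT p|H. iexp (t * x) * complex_of_real (g p x)))"
    unfolding integral_complex_of_real[symmetric] by (simp only: integral_mult_right_zero)
  also have "\<dots> = (LINT p|H. (LINT x|lborel. iexp (t * x) * complex_of_real (g p x)))"
    by (rule P.Fubini_integral[OF G'])
  also have "\<dots> = (LINT p|H. iexp (t * fst p) * complex_of_real (exp (- (snd p * t)\<^sup>2 / 2)))"
  proof (rule integral_cong_AE)
    show "AE p in H. (LINT x|lborel. iexp (t * x) * complex_of_real (g p x)) = iexp (t * fst p) * complex_of_real (exp (- (snd p * t)\<^sup>2 / 2))"
      using ae unfolding g_def by eventually_elim (subst char_normal_density; simp add: exp_of_real)
  qed measurable
  finally have I: "(LINT x|lborel. iexp (t * x) * complex_of_real (LINT p|H. g p x)) = \<dots>" .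
  have "(LINT x|lborel. iexp (t * x) * complex_of_real (mix_density \<epsilon> H x))
    = (LINT x|lborel. (1 - \<epsilon>) * (iexp (t * x) * complex_of_real (\<phi> x)) + \<epsilon> * (iexp (t * x) * complex_of_real (LINT p|H. g p x)))"
    unfolding mix by (intro Bochner_Integration.integral_cong refl) (simp add: algebra_simps)
  also have "\<dots> = (1 - \<epsilon>) * (LINT x|lborel. iexp (t * x) * complex_of_real (\<phi> x)) + \<epsilon> * (LINT x|lborel. iexp (t * x) * complex_of_real (LINT p|H. g p x))"
    using integrable_iexp_times[OF integrable_std_normal_density] integrable_iexp_times[OF Gx]
    by (simp del: of_real_diff)
  also have "(LINT x|lborel. iexp (t * x) * complex_of_real (\<phi> x)) = exp (- t\<^sup>2 / 2)"
    using char_normal_density[of 1 t 0] by (simp add: exp_of_real)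
  finally show "(LINT x|lborel. iexp (t * x) * complex_of_real (mix_density \<epsilon> H x))
       = (1 - \<epsilon>) * exp (- t\<^sup>2 / 2) + \<epsilon> * (LINT p|H. iexp (t * fst p) * complex_of_real (exp (- (snd p * t)\<^sup>2 / 2)))"
    unfolding I by simp
qed

lemma integral_mix_density: "(LINT x|lborel. mix_density \<epsilon> H x) = 1"
proof -
  have H: "prob_space H" using el by (auto simp: eligible_def)
  have "complex_of_real (LINT x|lborel. mix_density \<epsilon> H x) = (LINT x|lborel. iexp (0 * x) * complex_of_real (mix_density \<epsilon> H x))"
    unfolding integral_complex_of_real[symmetric] by simp
  also have "\<dots> = 1"
    unfolding char_mix_density using prob_space.prob_space[OF H] by simp
  finally show ?thesis by simp
qed

text \<open>
  Disintegrating the mixing distribution over \<open>\<sigma>\<close> turns the integral over \<open>u\<close> into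
  \<open>hhat h \<sigma> t\<close>, and \<open>\<sigma> \<ge> 1\<close> bounds the Gaussian factor by its value at \<open>\<sigma> = 1\<close>.
\<close>

lemma norm_smoothed_mixing_char_le:
  assumes b: "\<And>\<sigma>. 1 \<le> \<sigma> \<Longrightarrow> cmod (hhat h \<sigma> t) \<le> b"
  shows "cmod (LINT p|H. iexp (t * fst p) * complex_of_real (exp (- (snd p * t)\<^sup>2 / 2))) \<le> exp (- t\<^sup>2 / 2) * b"
proof -
  have H: "prob_space H" and sH [measurable_cong]: "sets H = sets (borel \<Otimes>\<^sub>M borel)"
    and ae: "AE p in H. 1 \<le> snd p" and [measurable]: "(\<lambda>p. h (fst p) (snd p)) \<in> borel_measurable (borel \<Otimes>\<^sub>M borel)"
    and hn: "\<And>\<sigma> u. 1 \<le> \<sigma> \<Longrightarrow> 0 \<le> h u \<sigma>"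
    and dis: "H = density (lborel \<Otimes>\<^sub>M distr H borel snd) (\<lambda>p. ennreal (h (fst p) (snd p)))"
    using el by (auto simp: eligible_def)
  interpret H: prob_space H by fact
  define S where "S = distr H borel snd"
  have [measurable_cong]: "sets S = sets borel" by (simp add: S_def)
  interpret S: prob_space S unfolding S_def by (rule H.prob_space_distr) measurable
  interpret P: pair_sigma_finite lborel S ..
  have aeS: "AE \<sigma> in S. 1 \<le> \<sigma>" unfolding S_def using ae by (subst AE_distr_iff) auto
  have aeP: "AE p in lborel \<Otimes>\<^sub>M S. 1 \<le> snd p"
  proof (rule P.AE_pair_measure)
    show "AE x in lborel. AE y in S. 1 \<le> snd (x, y)" using aeS by simp
  qed measurable
  have hP: "AE p in lborel \<Otimes>\<^sub>M S. 0 \<le> h (fst p) (snd p)" using aeP by eventually_elim (simp add: hn)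
  let ?F = "\<lambda>p. iexp (t * fst p) * complex_of_real (exp (- (snd p * t)\<^sup>2 / 2))"
  have FH: "integrable H ?F"
    by (rule H.integrable_const_bound[where B=1]) (auto simp: norm_mult)
  have iP: "integrable (lborel \<Otimes>\<^sub>M S) (\<lambda>p. h (fst p) (snd p) *\<^sub>R ?F p)"
    using FH hP unfolding S_def by (subst (asm) dis, subst (asm) integrable_density) auto
  have "(LINT p|H. ?F p) = (LINT p|(lborel \<Otimes>\<^sub>M S). h (fst p) (snd p) *\<^sub>R ?F p)"
    using hP unfolding S_def by (subst dis, subst integral_density) auto
  also have "\<dots> = (LINT \<sigma>|S. (LINT u|lborel. h u \<sigma> *\<^sub>R (iexp (t * u) * complex_of_real (exp (- (\<sigma> * t)\<^sup>2 / 2)))))"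
    by (rule P.integral_snd[of "\<lambda>u \<sigma>. h u \<sigma> *\<^sub>R (iexp (t * u) * complex_of_real (exp (- (\<sigma> * t)\<^sup>2 / 2)))",
          unfolded case_prod_beta, OF iP, symmetric])
  also have "\<dots> = (LINT \<sigma>|S. complex_of_real (exp (- (\<sigma> * t)\<^sup>2 / 2)) * hhat h \<sigma> t)"
    unfolding hhat_def integral_mult_right_zero[symmetric]
    by (simp add: scaleR_conv_of_real mult_ac)
  finally have eq: "(LINT p|H. ?F p) = (LINT \<sigma>|S. complex_of_real (exp (- (\<sigma> * t)\<^sup>2 / 2)) * hhat h \<sigma> t)" .
  have pt: "cmod (complex_of_real (exp (- (\<sigma> * t)\<^sup>2 / 2)) * hhat h \<sigma> t) \<le> exp (- t\<^sup>2 / 2) * b" if "1 \<le> \<sigma>" for \<sigma>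
  proof -
    have "1 * t\<^sup>2 \<le> \<sigma>\<^sup>2 * t\<^sup>2" using that by (intro mult_right_mono) auto
    then have "exp (- (\<sigma> * t)\<^sup>2 / 2) \<le> exp (- t\<^sup>2 / 2)" by (simp add: power_mult_distrib)
    then show ?thesis unfolding norm_mult using b[OF that] by (intro mult_mono) auto
  qed
  have b0: "0 \<le> b" by (rule order_trans[OF norm_ge_zero b[of 1]]) simp
  have "cmod (LINT p|H. ?F p) \<le> (LINT \<sigma>|S. cmod (complex_of_real (exp (- (\<sigma> * t)\<^sup>2 / 2)) * hhat h \<sigma> t))"
    unfolding eq by (rule integral_norm_bound)
  also have "\<dots> \<le> (LINT \<sigma>|S. exp (- t\<^sup>2 / 2) * b)"
  proof (rule integral_mono_AE')
    show "AE \<sigma> in S. cmod (complex_of_real (exp (- (\<sigma> * t)\<^sup>2 / 2)) * hhat h \<sigma> t) \<le> exp (- t\<^sup>2 / 2) * b"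
      by (rule eventually_mono[OF aeS]) (use pt in blast)
  qed (use b0 in auto)
  also have "\<dots> = exp (- t\<^sup>2 / 2) * b" by (simp add: S.prob_space)
  finally show ?thesis .
qed

end

text \<open>
  Bienayme's formula together with the squared bias \<open>b\<^sup>2\<close>. Keeping \<open>b\<close> arbitrary makes the
  induction work: integrating out all but one coordinate leaves the same expression with the shifted
  bias \<open>b - s * Y y\<close>.
\<close>

lemma nn_integral_square_of_centred_sum:
  fixes P :: "real measure" and Y :: "real \<Rightarrow> real"
  assumes "prob_space P" and [measurable]: "Y \<in> borel_measurable P"
    and mean: "(LINT y|P. Y y) = 0" and bd: "\<And>y. \<bar>Y y\<bar> \<le> K" and v: "v = (LINT y|P. (Y y)\<^sup>2)"
    and "finite I"
  shows "(\<integral>\<^sup>+X. ennreal ((b - s * (\<Sum>i\<in>I. Y (X i)))\<^sup>2) \<partial>(\<Pi>\<^sub>M i\<in>I. P)) = ennreal (b\<^sup>2 + s\<^sup>2 * (real (card I) * v))"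
  using \<open>finite I\<close>
proof (induction I arbitrary: b)
  case empty
  show ?case by (simp add: PiM_empty nn_integral_count_space_finite)
next
  case (insert i I)
  interpret prob_space P by fact
  interpret product_sigma_finite "\<lambda>_::'a. P" by standard
  have v0: "0 \<le> v" unfolding v by (intro Bochner_Integration.integral_nonneg) simp
  have iY: "integrable P Y" by (rule integrable_const_bound[where B=K]) (use bd in auto)
  have iY2: "integrable P (\<lambda>y. (Y y)\<^sup>2)"
    by (rule integrable_const_bound[where B="K\<^sup>2"]) (use bd in \<open>auto intro!: AE_I2 abs_le_square_iff[THEN iffD1] simp: order_trans[OF bd abs_ge_self]\<close>)
  let ?k = "real (card I) * v"
  have "(\<integral>\<^sup>+X. ennreal ((b - s * (\<Sum>j\<in>insert i I. Y (X j)))\<^sup>2) \<partial>(\<Pi>\<^sub>M i\<in>insert i I. P))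
     = (\<integral>\<^sup>+y. (\<integral>\<^sup>+X. ennreal ((b - s * (\<Sum>j\<in>insert i I. Y ((X(i := y)) j)))\<^sup>2) \<partial>(\<Pi>\<^sub>M i\<in>I. P)) \<partial>P)"
    using insert.hyps by (subst product_nn_integral_insert_rev) (auto intro!: measurable_compose[OF measurable_component_singleton] borel_measurable_sum)
  also have "\<dots> = (\<integral>\<^sup>+y. (\<integral>\<^sup>+X. ennreal (((b - s * Y y) - s * (\<Sum>j\<in>I. Y (X j)))\<^sup>2) \<partial>(\<Pi>\<^sub>M i\<in>I. P)) \<partial>P)"
  proof (intro nn_integral_cong arg_cong[where f=ennreal])
    fix y X
    have "(\<Sum>j\<in>insert i I. Y ((X(i := y)) j)) = Y y + (\<Sum>j\<in>I. Y (X j))"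
      using insert.hyps by (simp add: sum.insert) (intro sum.cong; auto)
    then show "(b - s * (\<Sum>j\<in>insert i I. Y ((X(i := y)) j)))\<^sup>2 = ((b - s * Y y) - s * (\<Sum>j\<in>I. Y (X j)))\<^sup>2"
      by (simp add: algebra_simps)
  qed
  also have "\<dots> = (\<integral>\<^sup>+y. ennreal ((b - s * Y y)\<^sup>2 + s\<^sup>2 * ?k) \<partial>P)"
    by (simp only: insert.IH)
  also have "\<dots> = ennreal (LINT y|P. (b - s * Y y)\<^sup>2 + s\<^sup>2 * ?k)"
  proof (rule nn_integral_eq_integral)
    have "(\<lambda>y. (b - s * Y y)\<^sup>2 + s\<^sup>2 * ?k) = (\<lambda>y. b\<^sup>2 + s\<^sup>2 * ?k - 2 * b * s * Y y + s\<^sup>2 * (Y y)\<^sup>2)"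
      by (simp add: power2_eq_square algebra_simps)
    then show "integrable P (\<lambda>y. (b - s * Y y)\<^sup>2 + s\<^sup>2 * ?k)" using iY iY2 by simp
  qed (use v0 in auto)
  also have "(LINT y|P. (b - s * Y y)\<^sup>2 + s\<^sup>2 * ?k) = (LINT y|P. (b\<^sup>2 + s\<^sup>2 * ?k) - 2 * b * s * Y y + s\<^sup>2 * (Y y)\<^sup>2)"
    by (simp add: power2_eq_square algebra_simps)
  also have "\<dots> = b\<^sup>2 + s\<^sup>2 * ?k + s\<^sup>2 * v"
    using iY iY2 mean v by (simp add: prob_space)
  also have "\<dots> = b\<^sup>2 + s\<^sup>2 * (real (card (insert i I)) * v)"
    using insert.hyps by (simp add: algebra_simps)
  finally show ?case .
qed

lemma Ftilde_unif_density:
  assumes "(a, f) \<in> Ftilde_unif T \<alpha> \<beta> \<epsilon>0 q A n"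
  shows "f \<in> borel_measurable borel" "0 \<le> f x" "integrable lborel f" "(LINT x|lborel. f x) = 1"
    "(\<integral>\<^sup>+x. ennreal (\<bar>x\<bar> powr q * f x) \<partial>lborel) \<le> ennreal (A powr q)"
  using assms mix_density_measurable mix_density_nonneg integrable_mix_density integral_mix_density
  unfolding Ftilde_unif_def in_class_def by auto

section \<open>The least favourable pair and the minimax lower bound\<close>

text \<open>
  Three constants are chosen in turn. The scale \<open>\<rho>\<close> of the common part \<open>g\<close>, a stretched copy of
  \<open>K1\<close>, makes its transform obey the smoothness bounds for all \<open>t\<close>. The ratio \<open>w\<close> keeps the
  spikes within the remaining half of these bounds. The total weight \<open>e0\<close> makes the moment
  bound and the bound on the proportion hold; the former is possible since the null component
  itself leaves room below \<open>A powr q\<close>. None of them depends on \<open>T\<close>, \<open>n\<close> or \<open>\<tau>\<close>.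
\<close>

lemma least_favourable_pair:
  fixes \<alpha> \<beta> \<epsilon>0 q A :: real
  assumes \<alpha>: "0 < \<alpha>" and \<beta>: "0 \<le> \<beta>" and \<epsilon>0: "0 < \<epsilon>0" and q: "0 \<le> q"
    and A: "0 < A" "abs_moment q < A powr q"
  obtains c B where "0 < c" "0 \<le> B"
    "\<And>T n \<tau>. 1 \<le> n \<Longrightarrow> 1 \<le> \<tau> \<Longrightarrow> \<exists>a0 a1 f0 f1.
        (a0, f0) \<in> Ftilde_unif T \<alpha> \<beta> \<epsilon>0 q A n \<and> (a1, f1) \<in> Ftilde_unif T \<alpha> \<beta> \<epsilon>0 q A n \<and>
        a1 - a0 = c * real n powr (- \<beta>) * \<tau> powr (- \<alpha>) \<and>
        (\<forall>x. \<bar>f1 x - f0 x\<bar> \<le> B * exp (- \<tau>\<^sup>2 / 4))"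
proof -
  obtain p :: nat where p: "max q 1 \<le> real p" using real_arch_simple by blast
  then have p: "1 \<le> p" "q \<le> real p" by auto
  obtain K1 K2 R where R: "0 < R" and K1: "band_kernel p R K1" and K2: "band_kernel p R K2"
    and K12: "\<And>t. \<bar>t\<bar> \<le> 1 \<Longrightarrow> fourier K1 t - fourier K2 t = 1"
    using exists_band_kernels[of p] by blast
  note k1 = band_kernelD[OF K1] and k2 = band_kernelD[OF K2]
  define b1 b2 m1 m2 q1 q2 where "b1 = (LINT u|lborel. K1 u)" and "b2 = (LINT u|lborel. K2 u)"
    and "m1 = (LINT u|lborel. \<bar>u\<bar> * K1 u)" and "m2 = (LINT u|lborel. \<bar>u\<bar> * K2 u)"
    and "q1 = (LINT u|lborel. \<bar>u\<bar> powr q * K1 u)" and "q2 = (LINT u|lborel. \<bar>u\<bar> powr q * K2 u)"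
  have nn: "0 \<le> b1" "0 \<le> b2" "0 \<le> m1" "0 \<le> m2" "0 \<le> q1" "0 \<le> q2"
    unfolding b1_def b2_def m1_def m2_def q1_def q2_def using k1(1) k2(1)
    by (auto intro!: Bochner_Integration.integral_nonneg)
  have "complex_of_real (b1 - b2) = complex_of_real 1"
    using K12[of 0] k1(2) k2(2) by (simp add: fourier_zero b1_def b2_def)
  then have b12: "b1 - b2 = 1" by (simp only: of_real_eq_iff)
  then have b1: "1 \<le> b1" using nn by linarith
  define M where "M = abs_moment q"
  have M: "0 \<le> M" unfolding M_def by (rule abs_moment_nonneg)
  define mg where "mg = m1 / b1"
  have mg: "0 \<le> mg" using nn b1 by (simp add: mg_def)
  obtain r where r: "0 < r" "r \<le> 1" "r * (R powr \<alpha> + R powr (\<alpha> + 1) * mg) \<le> A / 2"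
    using small_factor[of "A / 2" "R powr \<alpha> + R powr (\<alpha> + 1) * mg"] A mg by auto
  define \<rho> where "\<rho> = r powr (1 / \<alpha>)"
  have \<rho>: "0 < \<rho>" "\<rho> powr \<alpha> = r" using r \<alpha> by (simp_all add: \<rho>_def powr_powr)
  define g where "g u = rescale \<rho> (\<lambda>u. K1 u / b1) u" for u
  have K1b: "band_kernel p R (\<lambda>u. K1 u / b1)"
    using K1 b1 unfolding band_kernel_def fourier_def
    by (auto simp: integral_divide_zero)
  have g: "band_kernel p (\<rho> * R) g"
    unfolding g_def using band_kernel_rescale[OF K1b \<rho>(1)] by (simp add: rescale_def[abs_def])
  have g1: "(LINT u|lborel. g u) = 1" "(LINT u|lborel. \<bar>u\<bar> * g u) = mg / \<rho>"
    unfolding g_def integral_rescale[OF \<rho>(1)] mg_def m1_def using b1 by (simp_all flip: b1_def)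
  define Qg where "Qg = (LINT u|lborel. \<bar>u\<bar> powr q * g u)"
  have Qg: "0 \<le> Qg" unfolding Qg_def using band_kernelD(1)[OF g] by (intro Bochner_Integration.integral_nonneg) auto
  have rg: "r * R powr \<alpha> \<le> A / 2" "r * (R powr (\<alpha> + 1) * mg) \<le> A / 2"
  proof -
    have "0 \<le> r * R powr \<alpha>" "0 \<le> r * (R powr (\<alpha> + 1) * mg)" using r mg by auto
    then show "r * R powr \<alpha> \<le> A / 2" "r * (R powr (\<alpha> + 1) * mg) \<le> A / 2"
      using r(3) by (auto simp: distrib_left)
  qed
  have dg: "(\<rho> * R) powr \<alpha> \<le> A / 2" "(\<rho> * R) powr (\<alpha> + 1) * (LINT u|lborel. \<bar>u\<bar> * g u) \<le> A / 2"
  proof -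
    show "(\<rho> * R) powr \<alpha> \<le> A / 2" using \<rho> R rg(1) by (simp add: powr_mult)
    have "(\<rho> * R) powr (\<alpha> + 1) * (mg / \<rho>) = \<rho> powr \<alpha> * (R powr (\<alpha> + 1) * mg)"
      using \<rho> R by (simp add: powr_mult powr_add[of \<rho>])
    then show "(\<rho> * R) powr (\<alpha> + 1) * (LINT u|lborel. \<bar>u\<bar> * g u) \<le> A / 2"
      using rg(2) \<rho>(2) by (simp add: g1)
  qed
  define S where "S = R powr \<alpha> * (b1 + b2) + R powr (\<alpha> + 1) * (m1 + m2)"
  have S: "0 \<le> S" unfolding S_def using nn by simp
  obtain w where w: "0 < w" "w \<le> 1" "w * S \<le> A / 2" using small_factor[of "A / 2" S] A S by auto
  have ws: "w * (R powr \<alpha> * b) \<le> A / 2 \<and> w * (R powr (\<alpha> + 1) * m) \<le> A / 2"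
    if "b \<in> {b1, b2}" "m \<in> {m1, m2}" for b m
  proof -
    have "0 \<le> R powr \<alpha> * b1" "0 \<le> R powr \<alpha> * b2" "0 \<le> R powr (\<alpha> + 1) * m1" "0 \<le> R powr (\<alpha> + 1) * m2"
      using nn by auto
    then have "R powr \<alpha> * b \<le> S" "R powr (\<alpha> + 1) * m \<le> S"
      using that by (auto simp: S_def distrib_left)
    then show ?thesis using w mult_left_mono[of _ S w] by (smt (verit))
  qed
  define V where "V = 2 powr q * (M * (1 + b1 + b2) + (Qg + q1 + q2))"
  have V: "0 \<le> V" unfolding V_def using nn M Qg by simp
  obtain e0' where e0': "0 < e0'" "e0' \<le> 1" "e0' * V \<le> A powr q - M"
    using small_factor[of "A powr q - M" V] A V by (auto simp: M_def)
  obtain e0'' where e0'': "0 < e0''" "e0'' \<le> 1" "e0'' * (1 + b1 + b2) \<le> min \<epsilon>0 (1 / 2)"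
    using small_factor[of "min \<epsilon>0 (1 / 2)" "1 + b1 + b2"] \<epsilon>0 nn by auto
  define e0 where "e0 = min e0' e0''"
  have e0: "0 < e0" "e0 \<le> e0'" "e0 \<le> e0''" using e0' e0'' by (auto simp: e0_def)
  have e0V: "e0 * V \<le> A powr q - M" using mult_right_mono[OF e0(2) V] e0' by linarith
  have e0b: "e0 * (1 + b1 + b2) \<le> min \<epsilon>0 (1 / 2)"
    using mult_right_mono[OF e0(3), of "1 + b1 + b2"] e0'' nn by linarith
  show ?thesis
  proof (rule that[of "w * e0" "1 + (b1 + b2)"])
    show "0 < w * e0" "0 \<le> 1 + (b1 + b2)" using w e0 nn by auto
    fix T :: "real \<Rightarrow> real" and n :: nat and \<tau> :: real
    assume n: "1 \<le> n" and \<tau>: "1 \<le> \<tau>"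
    define e where "e = e0 * real n powr (- \<beta>)"
    define d where "d = w * e * \<tau> powr (- \<alpha>)"
    have nb: "0 < real n powr (- \<beta>)" "real n powr (- \<beta>) \<le> 1"
      using n \<beta> powr_mono[of "- \<beta>" 0 "real n"] by auto
    have e: "0 < e" "e \<le> e0" using e0 nb by (auto simp: e_def mult_left_le)
    have \<tau>\<alpha>: "0 < \<tau> powr (- \<alpha>)" "\<tau> powr (- \<alpha>) \<le> 1" using \<tau> \<alpha> powr_mono[of "- \<alpha>" 0 \<tau>] by auto
    have "w * e \<le> e" using w e by (simp add: mult_left_le_one_le)
    moreover have "d \<le> w * e" unfolding d_def using w e \<tau>\<alpha> by (intro mult_left_le) auto
    moreover have "0 < d" unfolding d_def using w e \<tau>\<alpha> by (intro mult_pos_pos) auto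
    ultimately have d: "0 < d" "d \<le> e" by auto
    define f where "f K x = (1 - (e + d * (LINT u|lborel. rescale \<tau> K u))) * \<phi> x
        + (e * gauss_conv g x + d * gauss_conv (rescale \<tau> K) x)" for K x
    have \<tau>0: "0 < \<tau>" using \<tau> by simp
    have mem: "(e + d * (LINT u|lborel. rescale \<tau> K u), f K) \<in> Ftilde_unif T \<alpha> \<beta> \<epsilon>0 q A n"
      if K: "band_kernel p R K" and b: "(LINT u|lborel. K u) \<in> {b1, b2}"
        and m: "(LINT u|lborel. \<bar>u\<bar> * K u) \<in> {m1, m2}" and q': "(LINT u|lborel. \<bar>u\<bar> powr q * K u) \<in> {q1, q2}" for K
    proof -
      define b' m' q'' where "b' = (LINT u|lborel. K u)" and "m' = (LINT u|lborel. \<bar>u\<bar> * K u)" and "q'' = (LINT u|lborel. \<bar>u\<bar> powr q * K u)"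
      have b': "0 \<le> b'" "b' \<le> b1 + b2" "b' \<in> {b1, b2}" and m': "m' \<in> {m1, m2}" and q'': "0 \<le> q''" "q'' \<le> q1 + q2"
        using b m q' nn unfolding b'_def[symmetric] m'_def[symmetric] q''_def[symmetric] by auto
      define \<epsilon> where "\<epsilon> = e + d * (LINT u|lborel. rescale \<tau> K u)"
      have \<epsilon>: "\<epsilon> = e + d * b'" by (simp add: \<epsilon>_def b'_def integral_rescale[OF \<tau>0])
      have db: "d * b' \<le> e * (b1 + b2)" using d b' by (intro mult_mono) auto
      have \<epsilon>le: "\<epsilon> \<le> e * (1 + b1 + b2)" using db by (simp add: \<epsilon> algebra_simps)
      also have "\<dots> = e0 * (1 + b1 + b2) * real n powr (- \<beta>)" by (simp add: e_def)
      also have "\<dots> \<le> min \<epsilon>0 (1 / 2) * real n powr (- \<beta>)" using e0b nb by (intro mult_right_mono) auto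
      finally have \<epsilon>n: "\<epsilon> \<le> min \<epsilon>0 (1 / 2) * real n powr (- \<beta>)" .
      also have "\<dots> \<le> \<epsilon>0 * real n powr (- \<beta>)" using nb by (intro mult_right_mono) auto
      finally have \<epsilon>A: "\<epsilon> \<le> \<epsilon>0 * real n powr (- \<beta>)" .
      have "min \<epsilon>0 (1 / 2) * real n powr (- \<beta>) \<le> 1 / 2 * 1" using nb \<epsilon>0 by (intro mult_mono) auto
      with \<epsilon>n have \<epsilon>1: "\<epsilon> < 1" by linarith
      have rq: "(LINT u|lborel. \<bar>u\<bar> powr q * rescale \<tau> K u) \<le> q''"
        unfolding integral_powr_rescale[OF \<tau>0] q''_def[symmetric]
        using \<tau> q q'' powr_mono[of "- q" 0 \<tau>] by (simp add: mult_left_le_one_le)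
      have de: "d * \<tau> powr \<alpha> = w * e" using \<tau> by (simp add: d_def powr_minus field_simps)
      have "(\<epsilon>, \<lambda>x. (1 - \<epsilon>) * \<phi> x + (e * gauss_conv g x + d * gauss_conv (rescale \<tau> K) x)) \<in> Ftilde_unif T \<alpha> \<beta> \<epsilon>0 q A n"
      proof (rule spiked_mixture_member[OF g g1(1) band_kernel_rescale[OF K \<tau>0] p(1) q p(2) _ _ \<alpha> e(1) _ \<epsilon>_def \<epsilon>1 \<epsilon>A _ dg])
        show "0 < \<rho> * R" "0 < \<tau> * R" using \<rho> R \<tau> by auto
        show "0 \<le> d" using d by simp
        have "d * (LINT u|lborel. \<bar>u\<bar> powr q * rescale \<tau> K u) \<le> e * (q1 + q2)"
        proof -
          have "d * (LINT u|lborel. \<bar>u\<bar> powr q * rescale \<tau> K u) \<le> d * q''" using rq d by (intro mult_left_mono) auto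
          also have "\<dots> \<le> e * (q1 + q2)" using d q'' by (intro mult_mono) auto
          finally show ?thesis .
        qed
        moreover have "M * \<epsilon> \<le> M * (e * (1 + b1 + b2))" using \<epsilon>le M by (intro mult_left_mono) auto
        ultimately have "2 powr q * (M * \<epsilon> + (e * Qg + d * (LINT u|lborel. \<bar>u\<bar> powr q * rescale \<tau> K u)))
            \<le> 2 powr q * (M * (e * (1 + b1 + b2)) + (e * Qg + e * (q1 + q2)))"
          by (intro mult_left_mono[of _ _ "2 powr q"]) (linarith, simp)
        also have "\<dots> = e * V" by (simp add: V_def algebra_simps)
        also have "\<dots> \<le> e0 * V" using e V by (intro mult_right_mono) auto
        finally show "abs_moment q + 2 powr q * (abs_moment q * \<epsilon> + (e * (LINT u|lborel. \<bar>u\<bar> powr q * g u) + d * (LINT u|lborel. \<bar>u\<bar> powr q * rescale \<tau> K u))) \<le> A powr q"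
          using e0V unfolding M_def[symmetric] Qg_def[symmetric] by linarith
        have "d * ((\<tau> * R) powr \<alpha> * b') = e * (w * (R powr \<alpha> * b'))"
          using de \<tau> R by (simp add: powr_mult)
        also have "\<dots> \<le> e * (A / 2)" using ws[OF b'(3) m'] e by (intro mult_left_mono) auto
        finally show "d * ((\<tau> * R) powr \<alpha> * (LINT u|lborel. rescale \<tau> K u)) \<le> e * (A / 2)"
          by (simp add: integral_rescale[OF \<tau>0] b'_def)
        have "d * ((\<tau> * R) powr (\<alpha> + 1) * (m' / \<tau>)) = (d * \<tau> powr \<alpha>) * (R powr (\<alpha> + 1) * m')"
          using \<tau> R by (simp add: powr_mult powr_add[of \<tau>])
        also have "\<dots> = e * (w * (R powr (\<alpha> + 1) * m'))" by (simp add: de)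
        also have "\<dots> \<le> e * (A / 2)" using ws[OF b'(3) m'] e by (intro mult_left_mono) auto
        finally show "d * ((\<tau> * R) powr (\<alpha> + 1) * (LINT u|lborel. \<bar>u\<bar> * rescale \<tau> K u)) \<le> e * (A / 2)"
          by (simp add: integral_rescale[OF \<tau>0] m'_def)
      qed
      then show ?thesis by (simp add: f_def[abs_def] \<epsilon>_def)
    qed
    have i1: "integrable lborel (rescale \<tau> K1)" and i2: "integrable lborel (rescale \<tau> K2)"
      by (rule band_kernelD(2)[OF band_kernel_rescale[OF K1 \<tau>0]], rule band_kernelD(2)[OF band_kernel_rescale[OF K2 \<tau>0]])
    have bound: "\<bar>f K1 x - f K2 x\<bar> \<le> (1 + (b1 + b2)) * exp (- \<tau>\<^sup>2 / 4)" for x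
    proof -
      define k where "k u = 1 * rescale \<tau> K1 u + (- 1) * rescale \<tau> K2 u" for u
      have kint: "integrable lborel k" unfolding k_def using i1 i2 by simp
      have kf: "fourier k t = fourier K1 (t / \<tau>) - fourier K2 (t / \<tau>)" for t
        unfolding k_def fourier_add[OF i1 i2] fourier_rescale[OF \<tau>0] by simp
      have "\<bar>gauss_conv k x - \<phi> x\<bar> \<le> (1 + (b1 + b2)) * exp (- \<tau>\<^sup>2 / 4)"
      proof (rule gauss_conv_approx[OF kint])
        show "fourier k t = 1" if "\<bar>t\<bar> \<le> \<tau>" for t
          unfolding kf using that \<tau> by (intro K12) simp
        show "cmod (fourier k t) \<le> b1 + b2" for t
        proof -
          have "cmod (fourier K1 (t / \<tau>)) \<le> b1" "cmod (fourier K2 (t / \<tau>)) \<le> b2"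
            using norm_fourier_le[of K1 "t / \<tau>"] norm_fourier_le[of K2 "t / \<tau>"] k1(1) k2(1)
            by (simp_all add: b1_def b2_def)
          then show ?thesis unfolding kf using norm_triangle_ineq4[of "fourier K1 (t / \<tau>)" "fourier K2 (t / \<tau>)"] by linarith
        qed
      qed (use \<tau> in simp)
      moreover have "f K1 x - f K2 x = d * (gauss_conv k x - (b1 - b2) * \<phi> x)"
        unfolding k_def gauss_conv_linear[OF i1 i2] f_def integral_rescale[OF \<tau>0] b1_def b2_def
        by (simp add: algebra_simps)
      moreover have "d * \<bar>gauss_conv k x - \<phi> x\<bar> \<le> 1 * \<bar>gauss_conv k x - \<phi> x\<bar>"
        using d e e0 e0' by (intro mult_right_mono) auto
      ultimately show ?thesis using d unfolding b12 by (simp add: abs_mult)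
    qed
    show "\<exists>a0 a1 f0 f1.
        (a0, f0) \<in> Ftilde_unif T \<alpha> \<beta> \<epsilon>0 q A n \<and> (a1, f1) \<in> Ftilde_unif T \<alpha> \<beta> \<epsilon>0 q A n \<and>
        a1 - a0 = w * e0 * real n powr (- \<beta>) * \<tau> powr (- \<alpha>) \<and>
        (\<forall>x. \<bar>f1 x - f0 x\<bar> \<le> (1 + (b1 + b2)) * exp (- \<tau>\<^sup>2 / 4))"
    proof (intro exI conjI allI)
      show "(e + d * (LINT u|lborel. rescale \<tau> K2 u), f K2) \<in> Ftilde_unif T \<alpha> \<beta> \<epsilon>0 q A n"
        by (rule mem[OF K2]) (simp_all add: b2_def m2_def q2_def)
      show "(e + d * (LINT u|lborel. rescale \<tau> K1 u), f K1) \<in> Ftilde_unif T \<alpha> \<beta> \<epsilon>0 q A n"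
        by (rule mem[OF K1]) (simp_all add: b1_def m1_def q1_def)
      have "e + d * (LINT u|lborel. rescale \<tau> K1 u) - (e + d * (LINT u|lborel. rescale \<tau> K2 u)) = d * (b1 - b2)"
        by (simp add: integral_rescale[OF \<tau>0] b1_def b2_def algebra_simps)
      then show "e + d * (LINT u|lborel. rescale \<tau> K1 u) - (e + d * (LINT u|lborel. rescale \<tau> K2 u)) = w * e0 * real n powr (- \<beta>) * \<tau> powr (- \<alpha>)"
        by (simp add: b12 d_def e_def)
      show "\<bar>f K1 x - f K2 x\<bar> \<le> (1 + (b1 + b2)) * exp (- \<tau>\<^sup>2 / 4)" for x by (rule bound)
    qed
  qed
qed

text \<open>
  The choice \<open>\<tau>\<^sup>2 = 12 * ln n\<close> makes the two densities agree up to order \<open>n powr (- 3)\<close>,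
  and integrating over \<open>[-n, n]\<close> costs one power of \<open>n\<close>. The tails contribute
  \<open>n powr (- q)\<close>, so the \<open>L\<^sup>1\<close> distance is of order \<open>n powr (- 2)\<close>, smaller than the
  \<open>1 / n\<close> that would allow the samples to be distinguished. As only the order of \<open>\<tau>\<close>
  enters the rate, the factor \<open>12\<close> costs no more than a constant.
\<close>

theorem minimax_risk_lower_bound:
  fixes \<alpha> \<beta> \<epsilon>0 q A :: real
  assumes \<alpha>: "0 < \<alpha>" and \<beta>: "0 \<le> \<beta>" and \<epsilon>0: "0 < \<epsilon>0" and q: "2 \<le> q"
    and A: "0 < A" "abs_moment q < A powr q"
  shows "\<exists>C>0. \<forall>T. \<forall>\<^sub>F n in sequentially. ennreal (C * opt_rate \<alpha> \<beta> n) \<le> minimax_risk (Ftilde_unif T \<alpha> \<beta> \<epsilon>0 q A n) n"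
proof -
  obtain c B where c: "0 < c" and B: "0 \<le> B"
    and pair: "\<And>T n \<tau>. 1 \<le> n \<Longrightarrow> 1 \<le> \<tau> \<Longrightarrow> \<exists>a0 a1 f0 f1.
        (a0, f0) \<in> Ftilde_unif T \<alpha> \<beta> \<epsilon>0 q A n \<and> (a1, f1) \<in> Ftilde_unif T \<alpha> \<beta> \<epsilon>0 q A n \<and>
        a1 - a0 = c * real n powr (- \<beta>) * \<tau> powr (- \<alpha>) \<and>
        (\<forall>x. \<bar>f1 x - f0 x\<bar> \<le> B * exp (- \<tau>\<^sup>2 / 4))"
    by (rule least_favourable_pair[OF \<alpha> \<beta> \<epsilon>0 _ A]) (use q in auto)
  define D where "D = 2 * B + 2 * A powr q"
  define C where "C = c\<^sup>2 * 12 powr (- \<alpha>) / 8"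
  have "0 < C" using c by (simp add: C_def)
  moreover have "\<forall>\<^sub>F n in sequentially. ennreal (C * opt_rate \<alpha> \<beta> n) \<le> minimax_risk (Ftilde_unif T \<alpha> \<beta> \<epsilon>0 q A n) n" for T
  proof -
    have "\<forall>\<^sub>F n in sequentially. 2 * D \<le> real n"
      using filterlim_real_sequentially by (simp add: filterlim_at_top)
    moreover have "\<forall>\<^sub>F n in sequentially. 3 \<le> n" by (rule eventually_ge_at_top)
    ultimately show ?thesis
    proof eventually_elim
      case (elim n)
      have n: "0 < real n" "1 \<le> n" using elim by auto
      have ln1: "1 \<le> ln (real n)"
        using elim e_less_272 exp_le ln_ge_iff[of "real n" 1] by simp
      define \<tau> where "\<tau> = sqrt (12 * ln (real n))"
      have \<tau>: "1 \<le> \<tau>" unfolding \<tau>_def using ln1 by (intro real_le_rsqrt) simp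
      have \<tau>2: "\<tau>\<^sup>2 = 12 * ln (real n)" unfolding \<tau>_def using ln1 by simp
      have ex: "exp (- \<tau>\<^sup>2 / 4) = real n powr (- 3)" unfolding \<tau>2 using n by (simp add: powr_def)
      have \<tau>\<alpha>: "(\<tau> powr (- \<alpha>))\<^sup>2 = 12 powr (- \<alpha>) * ln (real n) powr (- \<alpha>)"
      proof -
        have "(\<tau> powr (- \<alpha>))\<^sup>2 = (\<tau>\<^sup>2) powr (- \<alpha>)"
          using \<tau> by (simp add: power2_eq_square powr_mult)
        then show ?thesis unfolding \<tau>2 using ln1 by (simp add: powr_mult)
      qed
      obtain a0 a1 f0 f1 where m: "(a0, f0) \<in> Ftilde_unif T \<alpha> \<beta> \<epsilon>0 q A n" "(a1, f1) \<in> Ftilde_unif T \<alpha> \<beta> \<epsilon>0 q A n"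
        and a: "a1 - a0 = c * real n powr (- \<beta>) * \<tau> powr (- \<alpha>)" and close: "\<And>x. \<bar>f1 x - f0 x\<bar> \<le> B * exp (- \<tau>\<^sup>2 / 4)"
        using pair[OF n(2) \<tau>] by blast
      note d0 = Ftilde_unif_density[OF m(1)] and d1 = Ftilde_unif_density[OF m(2)]
      have "(LINT x|lborel. \<bar>f1 x - f0 x\<bar>) \<le> 2 * real n * (B * real n powr (- 3)) + 2 * A powr q * real n powr (- q)"
      proof (rule integral_abs_diff_le)
        show "\<bar>f1 x - f0 x\<bar> \<le> B * real n powr (- 3)" for x using close[of x] unfolding ex .
      qed (use d0 d1 n q B in simp_all)
      also have "\<dots> \<le> 2 * real n * (B * real n powr (- 3)) + 2 * A powr q * real n powr (- 2)"
        using q n by (intro add_left_mono mult_left_mono powr_mono) auto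
      also have "real n * (2 * real n * (B * real n powr (- 3)) + 2 * A powr q * real n powr (- 2)) = D / real n"
        using n by (simp add: D_def powr_minus powr_numeral field_simps power2_eq_square power3_eq_cube)
      finally have "real n * (LINT x|lborel. \<bar>f1 x - f0 x\<bar>) \<le> D / real n" using n by simp
      also have "\<dots> \<le> 1 / 2" using elim n by (simp add: field_simps)
      finally have dist: "real n * (LINT x|lborel. \<bar>f1 x - f0 x\<bar>) \<le> 1 / 2" .
      have rate: "C * opt_rate \<alpha> \<beta> n = (a1 - a0)\<^sup>2 / 8"
        unfolding a power_mult_distrib \<tau>\<alpha> C_def opt_rate_def
        using n by (simp add: power2_eq_square flip: powr_add)
      show ?case
        unfolding minimax_risk_def rate
        using m d0 d1 dist n by (intro INF_greatest two_point_lower_bound) auto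
    qed
  qed
  ultimately show ?thesis by blast
qed

section \<open>The maximal risk of the estimator\<close>

lemma eps_hat_measurable: "eps_hat \<gamma> n \<in> borel_measurable (\<Pi>\<^sub>M i\<in>{1..n}. borel)"
  unfolding eps_hat_def by measurable

text \<open>
  The normalisation \<open>n powr \<gamma>\<close> cancels \<open>exp (- t\<^sup>2 / 2)\<close>, so the part of the bias that comes
  from the null component disappears and the rest is \<open>\<epsilon>\<close> times a quantity bounded by
  \<open>(A + 1) * t powr (- \<alpha>)\<close>; here \<open>A + 1\<close> comes from the modulus \<open>T\<close> at \<open>\<delta> = 1\<close>.
\<close>

lemma nn_integral_eps_hat_le:
  assumes mem: "(\<epsilon>, f) \<in> Ftilde_unif T \<alpha> \<beta> \<epsilon>0 q A n"
    and \<gamma>: "0 < \<gamma>" and A: "0 < A" and n: "2 \<le> n" and large: "T 1 \<le> sqrt (2 * \<gamma> * ln (real n))"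
  shows "(\<integral>\<^sup>+X. ennreal ((eps_hat \<gamma> n X - \<epsilon>)\<^sup>2) \<partial>sample f n)
      \<le> ennreal ((\<epsilon>0 * (A + 1))\<^sup>2 * (2 * \<gamma>) powr (- \<alpha>) * opt_rate \<alpha> \<beta> n + real n powr (2 * \<gamma> - 1))"
proof -
  obtain H h where f: "f = mix_density \<epsilon> H" and cls: "in_class \<beta> \<epsilon>0 q A n \<epsilon> H h" and lm: "limsup_modulus T \<alpha> A h"
    using mem by (auto simp: Ftilde_unif_def)
  have el: "eligible \<epsilon> H h" and \<epsilon>n: "\<epsilon> \<le> \<epsilon>0 * real n powr (- \<beta>)" using cls by (auto simp: in_class_def)
  have \<epsilon>: "0 < \<epsilon>" "\<epsilon> < 1" using el by (auto simp: eligible_def)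
  note d = Ftilde_unif_density[OF mem]
  have [measurable]: "f \<in> borel_measurable borel" by (rule d)
  define t where "t = sqrt (2 * \<gamma> * ln (real n))"
  have n0: "0 < real n" "0 < ln (real n)" using n by auto
  have t: "0 < t" and t2: "t\<^sup>2 = 2 * \<gamma> * ln (real n)" unfolding t_def using \<gamma> n0 by auto
  have ex: "exp (- t\<^sup>2 / 2) = real n powr (- \<gamma>)" unfolding t2 using n0 by (simp add: powr_def)
  define z where "z = (LINT p|H. iexp (t * fst p) * complex_of_real (exp (- (snd p * t)\<^sup>2 / 2)))"
  have z: "cmod z \<le> real n powr (- \<gamma>) * ((A + 1) * t powr (- \<alpha>))"
    unfolding z_def ex[symmetric]
  proof (rule norm_smoothed_mixing_char_le[OF el])
    fix \<sigma> :: real assume "1 \<le> \<sigma>"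
    then have "\<bar>t\<bar> powr \<alpha> * cmod (hhat h \<sigma> t) \<le> A + 1"
      using lm large unfolding limsup_modulus_def t_def[symmetric] by (meson zero_less_one)
    then show "cmod (hhat h \<sigma> t) \<le> (A + 1) * t powr (- \<alpha>)"
      using t by (simp add: powr_minus field_simps)
  qed
  define \<mu> where "\<mu> = (LINT x|lborel. f x * cos (t * x))"
  have "\<mu> = (LINT x|lborel. Re (iexp (t * x) * complex_of_real (f x)))"
    unfolding \<mu>_def by (simp add: Re_exp mult.commute)
  also have "\<dots> = Re (LINT x|lborel. iexp (t * x) * complex_of_real (f x))"
    by (rule integral_Re) (rule integrable_iexp_times[OF d(3)])
  also have "(LINT x|lborel. iexp (t * x) * complex_of_real (f x)) = (1 - \<epsilon>) * exp (- t\<^sup>2 / 2) + \<epsilon> * z"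
    unfolding f z_def by (rule char_mix_density[OF el])
  finally have "\<mu> = Re ((1 - \<epsilon>) * exp (- t\<^sup>2 / 2) + \<epsilon> * z)" .
  then have \<mu>: "\<mu> = (1 - \<epsilon>) * real n powr (- \<gamma>) + \<epsilon> * Re z"
    unfolding ex by simp
  define s where "s = real n powr (- (1 - \<gamma>))"
  have sn: "s * real n = real n powr \<gamma>" using n0 by (simp add: s_def powr_diff powr_minus field_simps)
  define b where "b = 1 - s * real n * \<mu> - \<epsilon>"
  have unit: "real n powr \<gamma> * real n powr (- \<gamma>) = 1" using n0 by (simp flip: powr_add)
  from unit have b: "b = - \<epsilon> * (real n powr \<gamma> * Re z)"
    unfolding b_def sn \<mu> by (simp add: algebra_simps)
  have "\<bar>b\<bar> = \<epsilon> * (real n powr \<gamma> * \<bar>Re z\<bar>)" unfolding b using \<epsilon> by (simp add: abs_mult)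
  also have "\<dots> \<le> (\<epsilon>0 * real n powr (- \<beta>)) * (real n powr \<gamma> * (real n powr (- \<gamma>) * ((A + 1) * t powr (- \<alpha>))))"
    using \<epsilon> \<epsilon>n z abs_Re_le_cmod[of z] by (intro mult_mono) auto
  also have "\<dots> = \<epsilon>0 * (A + 1) * real n powr (- \<beta>) * t powr (- \<alpha>)"
    unfolding mult.assoc[of "real n powr \<gamma>", symmetric] unit by simp
  finally have "b\<^sup>2 \<le> (\<epsilon>0 * (A + 1) * real n powr (- \<beta>) * t powr (- \<alpha>))\<^sup>2"
    by (simp add: abs_le_square_iff[symmetric])
  also have "\<dots> = (\<epsilon>0 * (A + 1))\<^sup>2 * (2 * \<gamma>) powr (- \<alpha>) * opt_rate \<alpha> \<beta> n"
  proof -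
    have "(t powr (- \<alpha>))\<^sup>2 = (t\<^sup>2) powr (- \<alpha>)" using t by (simp add: power2_eq_square powr_mult)
    also have "\<dots> = (2 * \<gamma>) powr (- \<alpha>) * ln (real n) powr (- \<alpha>)" unfolding t2 using \<gamma> n0 by (simp add: powr_mult)
    finally have "(t powr (- \<alpha>))\<^sup>2 = (2 * \<gamma>) powr (- \<alpha>) * ln (real n) powr (- \<alpha>)" .
    moreover have "(real n powr (- \<beta>))\<^sup>2 = real n powr (- 2 * \<beta>)" by (simp add: power2_eq_square flip: powr_add)
    ultimately show ?thesis by (simp add: power_mult_distrib opt_rate_def)
  qed
  finally have b2: "b\<^sup>2 \<le> (\<epsilon>0 * (A + 1))\<^sup>2 * (2 * \<gamma>) powr (- \<alpha>) * opt_rate \<alpha> \<beta> n" .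
  define P where "P = density lborel (\<lambda>x. ennreal (f x))"
  have P: "prob_space P"
    unfolding P_def using d by (intro prob_spaceI) (simp add: emeasure_density nn_integral_eq_integral)
  interpret P: prob_space P by fact
  have [measurable_cong]: "sets P = sets borel" by (simp add: P_def)
  have EP: "(LINT x|P. g x) = (LINT x|lborel. f x * g x)" if "g \<in> borel_measurable borel" for g :: "real \<Rightarrow> real"
    unfolding P_def using that d by (subst integral_density) auto
  define Y where "Y x = cos (t * x) - \<mu>" for x
  have [measurable]: "Y \<in> borel_measurable P" unfolding Y_def by measurable
  have ic: "integrable P (\<lambda>x. cos (t * x))" "integrable P (\<lambda>x. (cos (t * x))\<^sup>2)"
    by (auto intro!: P.integrable_const_bound[where B=1] simp: abs_square_le_1)
  have Ec: "(LINT x|P. cos (t * x)) = \<mu>" by (simp add: EP \<mu>_def)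
  have EY: "(LINT x|P. Y x) = 0" unfolding Y_def using ic Ec by (simp add: P.prob_space)
  have VY: "(LINT x|P. (Y x)\<^sup>2) \<le> 1"
  proof -
    have "(LINT x|P. (Y x)\<^sup>2) = (LINT x|P. (cos (t * x))\<^sup>2 - 2 * \<mu> * cos (t * x) + \<mu>\<^sup>2)"
      unfolding Y_def by (simp add: power2_diff algebra_simps)
    also have "\<dots> = (LINT x|P. (cos (t * x))\<^sup>2) - \<mu>\<^sup>2"
      using ic by (simp add: Ec P.prob_space power2_eq_square)
    finally have "(LINT x|P. (Y x)\<^sup>2) = (LINT x|P. (cos (t * x))\<^sup>2) - \<mu>\<^sup>2" .
    moreover have "(LINT x|P. (cos (t * x))\<^sup>2) \<le> (LINT x|P. 1)"
      using ic by (intro integral_mono) (auto simp: abs_square_le_1)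
    moreover have "(LINT x|P. 1) = (1::real)" by (simp add: P.prob_space)
    ultimately show ?thesis using zero_le_power2[of \<mu>] by linarith
  qed
  have "(\<integral>\<^sup>+X. ennreal ((eps_hat \<gamma> n X - \<epsilon>)\<^sup>2) \<partial>sample f n)
      = (\<integral>\<^sup>+X. ennreal ((b - s * (\<Sum>i\<in>{1..n}. Y (X i)))\<^sup>2) \<partial>(\<Pi>\<^sub>M i\<in>{1..n}. P))"
    unfolding sample_def P_def[symmetric]
  proof (intro nn_integral_cong)
    fix X :: "nat \<Rightarrow> real"
    have "(\<Sum>i\<in>{1..n}. Y (X i)) = (\<Sum>j=1..n. cos (t * X j)) - real n * \<mu>"
      by (simp add: Y_def sum_subtractf)
    then have "eps_hat \<gamma> n X - \<epsilon> = b - s * (\<Sum>i\<in>{1..n}. Y (X i))"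
      unfolding eps_hat_def b_def s_def[symmetric] t_def[symmetric]
      by (simp only: right_diff_distrib mult.assoc)
    then show "ennreal ((eps_hat \<gamma> n X - \<epsilon>)\<^sup>2) = ennreal ((b - s * (\<Sum>i\<in>{1..n}. Y (X i)))\<^sup>2)" by simp
  qed
  also have "\<dots> = ennreal (b\<^sup>2 + s\<^sup>2 * (real (card {1..n}) * (LINT x|P. (Y x)\<^sup>2)))"
  proof (rule nn_integral_square_of_centred_sum[OF P _ EY _ refl])
    show "\<bar>Y y\<bar> \<le> 1 + \<bar>\<mu>\<bar>" for y
      unfolding Y_def by (rule order_trans[OF abs_triangle_ineq4]) simp
  qed auto
  also have "\<dots> \<le> ennreal ((\<epsilon>0 * (A + 1))\<^sup>2 * (2 * \<gamma>) powr (- \<alpha>) * opt_rate \<alpha> \<beta> n + real n powr (2 * \<gamma> - 1))"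
  proof (intro ennreal_leI add_mono b2)
    have "s\<^sup>2 * (real (card {1..n}) * (LINT x|P. (Y x)\<^sup>2)) \<le> s\<^sup>2 * (real n * 1)"
      using mult_left_mono[OF VY, of "real n"] by (intro mult_left_mono[of _ _ "s\<^sup>2"]) auto
    also have "\<dots> = s * (s * real n)" by (simp add: power2_eq_square)
    also have "\<dots> = real n powr (2 * \<gamma> - 1)" unfolding sn unfolding s_def by (simp flip: powr_add)
    finally show "s\<^sup>2 * (real (card {1..n}) * (LINT x|P. (Y x)\<^sup>2)) \<le> real n powr (2 * \<gamma> - 1)" .
  qed
  finally show ?thesis .
qed

theorem max_risk_eps_hat_upper_bound:
  fixes \<gamma> \<alpha> \<beta> \<epsilon>0 q A :: real
  assumes \<gamma>: "0 < \<gamma>" and A: "0 < A"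
  shows "\<exists>C>0. \<forall>T. \<forall>\<^sub>F n in sequentially.
     max_risk (Ftilde_unif T \<alpha> \<beta> \<epsilon>0 q A n) n (eps_hat \<gamma> n) \<le> ennreal (C * (opt_rate \<alpha> \<beta> n + real n powr (2 * \<gamma> - 1)))"
proof -
  define C where "C = 1 + (\<epsilon>0 * (A + 1))\<^sup>2 * (2 * \<gamma>) powr (- \<alpha>)"
  have C: "1 \<le> C" by (simp add: C_def)
  have "\<forall>\<^sub>F n in sequentially. max_risk (Ftilde_unif T \<alpha> \<beta> \<epsilon>0 q A n) n (eps_hat \<gamma> n)
      \<le> ennreal (C * (opt_rate \<alpha> \<beta> n + real n powr (2 * \<gamma> - 1)))" for T
  proof -
    have "filterlim (\<lambda>n. sqrt (2 * \<gamma> * ln (real n))) at_top sequentially"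
      using \<gamma> by real_asymp
    then have "\<forall>\<^sub>F n in sequentially. T 1 \<le> sqrt (2 * \<gamma> * ln (real n))"
      by (simp add: filterlim_at_top)
    moreover have "\<forall>\<^sub>F n in sequentially. 2 \<le> n" by (rule eventually_ge_at_top)
    ultimately show ?thesis
    proof eventually_elim
      case (elim n)
      show ?case
        unfolding max_risk_def
      proof (rule SUP_least, clarify)
        fix \<epsilon> f assume m: "(\<epsilon>, f) \<in> Ftilde_unif T \<alpha> \<beta> \<epsilon>0 q A n"
        have o: "0 \<le> opt_rate \<alpha> \<beta> n" by (simp add: opt_rate_def)
        have "(C - 1) * opt_rate \<alpha> \<beta> n \<le> C * opt_rate \<alpha> \<beta> n" using o by (intro mult_right_mono) auto
        moreover have "1 * real n powr (2 * \<gamma> - 1) \<le> C * real n powr (2 * \<gamma> - 1)" using C by (intro mult_right_mono) auto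
        ultimately have "(C - 1) * opt_rate \<alpha> \<beta> n + real n powr (2 * \<gamma> - 1) \<le> C * (opt_rate \<alpha> \<beta> n + real n powr (2 * \<gamma> - 1))"
          by (simp add: distrib_left)
        then show "(\<integral>\<^sup>+X. ennreal ((eps_hat \<gamma> n X - \<epsilon>)\<^sup>2) \<partial>sample f n) \<le> ennreal (C * (opt_rate \<alpha> \<beta> n + real n powr (2 * \<gamma> - 1)))"
          using nn_integral_eps_hat_le[OF m \<gamma> A elim(2) elim(1)] by (auto simp: C_def intro: order_trans ennreal_leI)
      qed
    qed
  qed
  then show ?thesis using C by (intro exI[of _ C]) auto
qed

text \<open>
  The condition on \<open>\<gamma>\<close> says that \<open>n powr (2 * \<gamma> - 1)\<close> is smaller than \<open>n powr (- 2 * \<beta>)\<close>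
  by a power of \<open>n\<close>, which beats the logarithmic factor.
\<close>

lemma variance_term_le_opt_rate:
  assumes "\<gamma> < 1 / 2 - \<beta>"
  shows "\<forall>\<^sub>F n in sequentially. real n powr (2 * \<gamma> - 1) \<le> opt_rate \<alpha> \<beta> n"
proof -
  have "2 * \<gamma> - 1 < - 2 * \<beta>" using assms by simp
  then show ?thesis unfolding opt_rate_def by real_asymp
qed

section \<open>The optimal rate of convergence\<close>

theorem theorem3p1:
  fixes \<gamma> \<alpha> \<beta> \<epsilon>0 q A :: real
  assumes "0 < \<gamma>" "\<gamma> < 1/2" "0 < \<alpha>" "0 \<le> \<beta>" "\<beta> < 1/2" "0 < \<epsilon>0" "\<epsilon>0 < 1" "2 \<le> q"
    and "A > sqrt 2 * abs_moment q powr (1 / q)"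
  shows "(\<exists>C>0. \<forall>T :: real \<Rightarrow> real. \<forall>\<^sub>F n in sequentially.
            ennreal (C * opt_rate \<alpha> \<beta> n) \<le> minimax_risk (Ftilde_unif T \<alpha> \<beta> \<epsilon>0 q A n) n)
       \<and> (\<exists>C>0. \<forall>T :: real \<Rightarrow> real. \<forall>\<^sub>F n in sequentially.
            max_risk (Ftilde_unif T \<alpha> \<beta> \<epsilon>0 q A n) n (eps_hat \<gamma> n)
              \<le> ennreal (C * (opt_rate \<alpha> \<beta> n + real n powr (2 * \<gamma> - 1))))
       \<and> (\<gamma> < 1/2 - \<beta> \<longrightarrow>
          (\<exists>c>0. \<exists>C>0. \<forall>T :: real \<Rightarrow> real. \<forall>\<^sub>F n in sequentially.
            ennreal (c * opt_rate \<alpha> \<beta> n) \<le> minimax_risk (Ftilde_unif T \<alpha> \<beta> \<epsilon>0 q A n) n \<and>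
            minimax_risk (Ftilde_unif T \<alpha> \<beta> \<epsilon>0 q A n) n
              \<le> max_risk (Ftilde_unif T \<alpha> \<beta> \<epsilon>0 q A n) n (eps_hat \<gamma> n) \<and>
            max_risk (Ftilde_unif T \<alpha> \<beta> \<epsilon>0 q A n) n (eps_hat \<gamma> n)
              \<le> ennreal (C * opt_rate \<alpha> \<beta> n)))"
proof -
  let ?m = "abs_moment q powr (1 / q)"
  have "?m \<le> sqrt 2 * ?m" using mult_right_mono[of 1 "sqrt 2" ?m] by simp
  then have mA: "?m < A" using assms(9) by linarith
  have A: "0 < A" using mA powr_ge_zero[of "abs_moment q" "1 / q"] by linarith
  have "abs_moment q = ?m powr q" using assms(8) abs_moment_nonneg[of q] by (simp add: powr_powr)
  also have "\<dots> < A powr q" using mA assms(8) by (intro powr_less_mono2) auto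
  finally have Aq: "abs_moment q < A powr q" .
  obtain c where c: "c > 0" "\<And>T. \<forall>\<^sub>F n in sequentially. ennreal (c * opt_rate \<alpha> \<beta> n) \<le> minimax_risk (Ftilde_unif T \<alpha> \<beta> \<epsilon>0 q A n) n"
    using minimax_risk_lower_bound[OF assms(3,4,6,8) A Aq] by blast
  obtain C where C: "C > 0" "\<And>T. \<forall>\<^sub>F n in sequentially. max_risk (Ftilde_unif T \<alpha> \<beta> \<epsilon>0 q A n) n (eps_hat \<gamma> n)
              \<le> ennreal (C * (opt_rate \<alpha> \<beta> n + real n powr (2 * \<gamma> - 1)))"
    using max_risk_eps_hat_upper_bound[OF assms(1) A] by blast
  have "\<forall>\<^sub>F n in sequentially.
            ennreal (c * opt_rate \<alpha> \<beta> n) \<le> minimax_risk (Ftilde_unif T \<alpha> \<beta> \<epsilon>0 q A n) n \<and>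
            minimax_risk (Ftilde_unif T \<alpha> \<beta> \<epsilon>0 q A n) n
              \<le> max_risk (Ftilde_unif T \<alpha> \<beta> \<epsilon>0 q A n) n (eps_hat \<gamma> n) \<and>
            max_risk (Ftilde_unif T \<alpha> \<beta> \<epsilon>0 q A n) n (eps_hat \<gamma> n)
              \<le> ennreal (2 * C * opt_rate \<alpha> \<beta> n)" if \<gamma>: "\<gamma> < 1/2 - \<beta>" for T
    using c(2)[of T] C(2)[of T] variance_term_le_opt_rate[OF \<gamma>, of \<alpha>]
  proof eventually_elim
    case (elim n)
    have "minimax_risk (Ftilde_unif T \<alpha> \<beta> \<epsilon>0 q A n) n \<le> max_risk (Ftilde_unif T \<alpha> \<beta> \<epsilon>0 q A n) n (eps_hat \<gamma> n)"
      unfolding minimax_risk_def by (rule INF_lower[OF eps_hat_measurable])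
    moreover have "C * (opt_rate \<alpha> \<beta> n + real n powr (2 * \<gamma> - 1)) \<le> C * (opt_rate \<alpha> \<beta> n + opt_rate \<alpha> \<beta> n)"
      using elim(3) C(1) by (intro mult_left_mono add_left_mono) auto
    then have "ennreal (C * (opt_rate \<alpha> \<beta> n + real n powr (2 * \<gamma> - 1))) \<le> ennreal (2 * C * opt_rate \<alpha> \<beta> n)"
      by (intro ennreal_leI) (simp add: mult_ac)
    ultimately show ?case using elim by (auto intro: order_trans)
  qed
  moreover have "0 < 2 * C" using C(1) by simp
  ultimately show ?thesis using c C by blast
qed

end
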